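(* Let $n$ be a positive integer and let $k,r,a$ be complex numbers such that all the functions below are defined. Then $$\sum _{p=1}^n \left(i 3^{-p}\right)^{1+k} \left(\sqrt[3]{-1}\, e^{i 3^{-p} \pi r}\, \Phi \left(-\sqrt[3]{-1}\, e^{i 3^{-p} \pi r},-k,1+3^p a\right)+e^{\pi \left(-\frac{i}{3}+i 3^{-p} r\right)}\, \Phi \left((-1)^{2/3} e^{i 3^{-p} \pi r},-k,1+3^p a\right)\right)$$ $$=-i e^{\frac{1}{2} i \pi (k+2 r)}\, \Phi \left(e^{i \pi r},-k,1+a\right)+\left(i 3^{-n}\right)^{1+k} e^{i 3^{-n} \pi r}\, \Phi \left(e^{i 3^{-n} \pi r},-k,1+3^n a\right).$$
   Context: $\Phi(z,s,v)$ is the Hurwitz–Lerch zeta function: $\Phi(z,s,v)=\sum_{j=0}^{\infty}\frac{z^j}{(j+v)^s}$ for $v\notin\{0,-1,-2,\dots\}$ and $|z|<1$ (or $|z|=1$, $\operatorname{Re}s>1$), and by analytic continuation (principal branch, cut along $z\in[1,\infty)$) for other values; $\Phi(1,s,v)$ is the Hurwitz zeta function $\zeta(s,v)$. Powers and roots are principal values; in particular $\sqrt[3]{-1}=e^{i\pi/3}$ and $(-1)^{2/3}=e^{2i\pi/3}$. *)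

theory Defs
  imports "HOL-Complex_Analysis.Complex_Analysis"
begin

definition lerch_term :: "complex \<Rightarrow> complex \<Rightarrow> complex \<Rightarrow> nat \<Rightarrow> complex" where
  "lerch_term z s v j = z ^ j / (of_nat j + v) powr s"

definition lerch_cut :: "complex set" where
  "lerch_cut = complex_of_real ` {1..}"

(* Continuation in z, with s and v fixed. The slit plane is connected and contains the unit disc,
   so the values of the chosen function on the slit plane are uniquely determined. *)
definition lerch_phi_continuation :: "complex \<Rightarrow> complex \<Rightarrow> complex \<Rightarrow> complex" where
  "lerch_phi_continuation s v =
     (SOME f. f holomorphic_on (- lerch_cut) \<and> (\<forall>z\<in>ball 0 1. lerch_term z s v sums f z))"

(* Continuation in s, with v fixed, to the plane without the pole s = 1; the value at s = 1 is
   unspecified. *)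
definition hurwitz_zeta :: "complex \<Rightarrow> complex \<Rightarrow> complex" where
  "hurwitz_zeta s v =
     (SOME f. f holomorphic_on (- {1}) \<and> (\<forall>s. Re s > 1 \<longrightarrow> lerch_term 1 s v sums f s)) s"

definition lerch_phi :: "complex \<Rightarrow> complex \<Rightarrow> complex \<Rightarrow> complex" where
  "lerch_phi z s v =
     (if norm z < 1 \<or> norm z = 1 \<and> Re s > 1 then (\<Sum>j. lerch_term z s v j)
      else if z = 1 then hurwitz_zeta s v
      else lerch_phi_continuation s v z)"

(* Where lerch_phi carries its mathematical meaning. Of the points on the cut only the branch
   point z = 1 is admitted, where the value is the Hurwitz zeta function (with pole at s = 1). *)
definition lerch_phi_defined :: "complex \<Rightarrow> complex \<Rightarrow> complex \<Rightarrow> bool" where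
  "lerch_phi_defined z s v \<longleftrightarrow>
     v \<notin> \<int>\<^sub>\<le>\<^sub>0 \<and> (z \<notin> lerch_cut \<or> z = 1 \<and> s \<noteq> 1)"

end

theory Submission
  imports Defs "HOL-Real_Asymp.Real_Asymp"
begin

text \<open>
  Put \<open>s = -k\<close>, \<open>w p = exp (i \<pi> r / 3^p)\<close>, so that \<open>w (p+1)\<close> is a cube root of \<open>w p\<close>, and let
  \<open>q = exp (2 \<pi> i / 3)\<close>. Sorting the terms of the Lerch series by the residue of the summation index
  modulo 3 gives the trisection identity
    \<open>w \<Phi>(w,s,v) + q w \<Phi>(q w,s,v) + q\<^sup>2 w \<Phi>(q\<^sup>2 w,s,v) = 3^(1-s) w\<^sup>3 \<Phi>(w\<^sup>3,s,(v+2)/3)\<close>,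
  because the cube roots of unity cancel all indices but those congruent to 2. Since
  \<open>(-1)^(1/3) = - q\<^sup>2\<close> and \<open>exp (- i \<pi> / 3) = - q\<close>, the summand with index \<open>p\<close> is, up to the factor
  \<open>(i/3^p)^(1+k)\<close>, the negative of the second and third terms on the left for \<open>w = w p\<close> and
  \<open>v = 1 + 3^p a\<close>. Then \<open>(v+2)/3 = 1 + 3^(p-1) a\<close>, so the summand equals \<open>X p - X (p-1)\<close> for
  \<open>X p = (i/3^p)^(1+k) w p \<Phi>(w p, -k, 1 + 3^p a)\<close>, and the sum telescopes to \<open>X n - X 0\<close>.

  What takes work is that \<open>\<Phi>\<close> is defined by analytic continuation, so the trisection has to be carried
  from the region of convergence to all admissible arguments, and the continuations have to be shown to
  exist. If \<open>w\<^sup>3\<close> is off the cut, the identity propagates in \<open>w\<close> from the unit disc, through the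
  star-shaped set of all such \<open>w\<close>. If \<open>w\<^sup>3 = 1\<close>, the term with argument 1 is a Hurwitz zeta value, and the
  identity propagates in \<open>s\<close> from the half plane \<open>Re s > 1\<close>; this requires that for fixed \<open>z\<close> off the cut
  the continuation in \<open>z\<close> is an entire function of \<open>s\<close> (lemma
  \<open>holomorphic_lerch_phi_continuation_exponent\<close>) and that it has the expected boundary values on the
  unit circle (lemma \<open>lerch_term_sums_lerch_phi_continuation_closed_disc\<close>).

  The continuation in \<open>z\<close> comes from the moments
  \<open>\<integral> (- ln x)^(s-1) x^(v+j-1) dx = \<Gamma>(s) (j+v)^(-s)\<close> on \<open>[0,1]\<close>: integrating the weight against
  \<open>1/(1 - z x)\<close> gives \<open>\<Gamma>(s) \<Phi>(z,s,v)\<close>, and the integral makes sense on the whole slit plane. Replacing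
  \<open>1/(1 - z x)\<close> by its images under powers of \<open>v + y d/dy\<close> lowers \<open>s\<close> step by step. The Hurwitz zeta
  function is continued by the recursion
  \<open>h(s,v) = v^(1-s) + (s-1) \<integral> (1-u) h(s+1,v+u) du\<close> for \<open>h(s,v) = (s-1) \<zeta>(s,v)\<close>.
\<close>

section \<open>Integrals depending on a complex parameter\<close>

text \<open>
  By Morera's theorem: the integral over a triangle may be moved inside, where it vanishes by
  Cauchy's theorem.
\<close>
lemma holomorphic_on_integral_param:
  fixes F :: "complex \<Rightarrow> real \<Rightarrow> complex"
  assumes S: "open S"
    and cont: "continuous_on (S \<times> {0..1}) (\<lambda>(s, u). F s u)"
    and hol: "\<And>u. u \<in> {0..1} \<Longrightarrow> (\<lambda>s. F s u) holomorphic_on S"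
  shows "(\<lambda>s. integral {0..1} (F s)) holomorphic_on S"
proof -
  \<comment> \<open>Write the parameter integral as an integral along the segment from \<open>0\<close> to \<open>1\<close>.\<close>
  have line: "contour_integral (linepath 0 1) (\<lambda>w. g (Re w)) = integral {0..1} g"
    for g :: "real \<Rightarrow> complex"
    by (simp add: contour_integral_integral linepath_def scaleR_conv_of_real)
  have "(\<lambda>s. integral {0..1} (F s)) analytic_on S"
  proof (rule Morera_triangle)
    show "continuous_on S (\<lambda>s. integral {0..1} (F s))"
      using integral_continuous_on_param[of S 0 1 F] cont by simp
    show "open S" by fact
    fix a b c
    show "convex hull {a, b, c} \<subseteq> S \<longrightarrow>
          contour_integral (linepath a b) (\<lambda>s. integral {0..1} (F s)) +
          contour_integral (linepath b c) (\<lambda>s. integral {0..1} (F s)) +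
          contour_integral (linepath c a) (\<lambda>s. integral {0..1} (F s)) = 0"
    proof
      assume hull: "convex hull {a, b, c} \<subseteq> S"
      define I where "I p q u = contour_integral (linepath p q) (\<lambda>s. F s u)" for p q u
      have swap: "contour_integral (linepath p q) (\<lambda>s. integral {0..1} (F s)) = integral {0..1} (I p q)"
        and int: "I p q integrable_on {0..1}"
        if "closed_segment p q \<subseteq> S" for p q
      proof -
        have "continuous_on (closed_segment p q \<times> closed_segment 0 1)
            (\<lambda>y. case (fst y, Re (snd y)) of (s, u) \<Rightarrow> F s u)"
        proof (rule continuous_on_compose2[OF cont])
          have "Re w \<in> {0..1}" if "w \<in> closed_segment 0 1" for w
            using that by (auto simp: closed_segment_def)
          then show "(\<lambda>y. (fst y, Re (snd y))) ` (closed_segment p q \<times> closed_segment 0 1) \<subseteq> S \<times> {0..1}"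
            using that by auto
        qed (intro continuous_intros)
        then have "continuous_on (closed_segment p q \<times> closed_segment 0 1) (\<lambda>(s, w). F s (Re w))"
          by (simp add: split_beta)
        then have "contour_integral (linepath p q) (\<lambda>s. contour_integral (linepath 0 1) (\<lambda>w. F s (Re w)))
            = contour_integral (linepath 0 1) (\<lambda>w. contour_integral (linepath p q) (\<lambda>s. F s (Re w)))"
          by (intro contour_integral_swap) (auto simp: vector_derivative_linepath_at)
        then show "contour_integral (linepath p q) (\<lambda>s. integral {0..1} (F s)) = integral {0..1} (I p q)"
          using line[of "I p q"] by (simp add: line I_def[abs_def])
        have lp: "continuous_on ({0..1 :: real} \<times> cbox 0 1) (\<lambda>y. linepath p q (snd y))"
          unfolding linepath_def by (intro continuous_intros)
        have "continuous_on ({0..1} \<times> cbox 0 1)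
            (\<lambda>y. case (linepath p q (snd y), fst y) of (s, u) \<Rightarrow> F s u * (q - p))"
        proof (rule continuous_on_compose2[where g = "\<lambda>(s, u). F s u * (q - p)" and t = "S \<times> {0..1}",
                OF _ continuous_on_Pair])
          show "continuous_on (S \<times> {0..1}) (\<lambda>(s, u). F s u * (q - p))"
            using cont by (auto simp: split_beta intro: continuous_intros)
          show "(\<lambda>y. (linepath p q (snd y), fst y)) ` ({0..1} \<times> cbox 0 1) \<subseteq> S \<times> {0..1}"
            using that linepath_in_path[of _ p q] by fastforce
        qed (rule lp, intro continuous_intros)
        then have "continuous_on ({0..1} \<times> cbox 0 1) (\<lambda>(u, t). F (linepath p q t) u * (q - p))"
          by (simp add: split_beta)
        from integral_continuous_on_param[OF this]
        show "I p q integrable_on {0..1}"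
          unfolding I_def contour_integral_integral
          by (intro integrable_continuous_interval) simp
      qed
      have seg: "closed_segment a b \<subseteq> S" "closed_segment b c \<subseteq> S" "closed_segment c a \<subseteq> S"
        using hull hull_mono[of "{a, b}" "{a, b, c}" convex] hull_mono[of "{b, c}" "{a, b, c}" convex]
          hull_mono[of "{c, a}" "{a, b, c}" convex]
        by (simp_all add: segment_convex_hull)
      have zero: "I a b u + I b c u + I c a u = 0" if "u \<in> {0..1}" for u
      proof -
        have "((\<lambda>s. F s u) has_contour_integral 0) (linepath a b +++ linepath b c +++ linepath c a)"
          using hol[OF that] hull by (intro Cauchy_theorem_triangle) (rule holomorphic_on_subset)
        then have "contour_integral (linepath a b +++ linepath b c +++ linepath c a) (\<lambda>s. F s u) = 0"
          by (rule contour_integral_unique)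
        moreover have "(\<lambda>s. F s u) contour_integrable_on (linepath p q)" if "closed_segment p q \<subseteq> S" for p q
          using holomorphic_on_imp_continuous_on[OF hol[OF \<open>u \<in> {0..1}\<close>]] that
          by (intro contour_integrable_continuous_linepath) (rule continuous_on_subset)
        ultimately show ?thesis
          unfolding I_def using seg by (simp add: contour_integrable_joinI add.assoc)
      qed
      have "integral {0..1} (I a b) + integral {0..1} (I b c) + integral {0..1} (I c a)
            = integral {0..1} (\<lambda>u. I a b u + I b c u + I c a u)"
        using int seg by (simp add: integral_add integrable_add)
      also have "\<dots> = integral {0..1} (\<lambda>_::real. 0)" by (rule integral_cong) (rule zero)
      finally show "contour_integral (linepath a b) (\<lambda>s. integral {0..1} (F s)) +
          contour_integral (linepath b c) (\<lambda>s. integral {0..1} (F s)) +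
          contour_integral (linepath c a) (\<lambda>s. integral {0..1} (F s)) = 0"
        using swap seg by simp
    qed
  qed
  then show ?thesis by (rule analytic_imp_holomorphic)
qed

lemma integral_sums_M_test:
  fixes f :: "nat \<Rightarrow> real \<Rightarrow> complex"
  assumes "\<And>j. continuous_on {0..1} (f j)"
    and "\<forall>\<^sub>F j in sequentially. \<forall>x\<in>{0..1}. norm (f j x) \<le> M j" and "summable M"
  shows "(\<lambda>j. integral {0..1} (f j)) sums integral {0..1} (\<lambda>x. \<Sum>j. f j x)"
proof -
  have "uniform_limit {0..1} (\<lambda>n x. \<Sum>j<n. f j x) (\<lambda>x. \<Sum>j. f j x) sequentially"
    using assms(2,3) by (rule Weierstrass_m_test_ev)
  then obtain I J where I: "\<And>n. ((\<lambda>x. \<Sum>j<n. f j x) has_integral I n) {0..1}"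
    and J: "((\<lambda>x. \<Sum>j. f j x) has_integral J) {0..1}" and lim: "I \<longlonglongrightarrow> J"
    by (rule uniform_limit_integral) (auto intro!: continuous_intros assms(1))
  have "I = (\<lambda>n. \<Sum>j<n. integral {0..1} (f j))"
    using integral_unique[OF I]
    by (simp add: fun_eq_iff integral_sum integrable_continuous_interval assms(1))
  then show ?thesis
    using lim integral_unique[OF J] by (simp add: sums_def)
qed

section \<open>The Mellin transform behind the Gamma function\<close>

text \<open>
  Both factors are total powers with \<open>0 powr _ = 0\<close>, so the weight vanishes at the two ends of the unit
  interval, which are also its limits there when \<open>Re s > 1\<close> and \<open>Re v > 1\<close>.
\<close>
definition mellin_weight :: "complex \<Rightarrow> complex \<Rightarrow> real \<Rightarrow> complex" where
  "mellin_weight s v x = of_real (- ln x) powr (s - 1) * of_real x powr (v - 1)"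

lemma continuous_on_x_ln_x: "continuous_on {0..} (\<lambda>x::real. x * ln x)"
  unfolding continuous_on_eq_continuous_within
proof
  fix x :: real assume x: "x \<in> {0..}"
  show "continuous (at x within {0..}) (\<lambda>x. x * ln x)"
  proof (cases "x = 0")
    case True
    have "((\<lambda>x::real. x * ln x) \<longlongrightarrow> 0) (at_right 0)" by real_asymp
    then show ?thesis using True by (simp add: continuous_within at_within_Ici_at_right)
  next
    case False
    then show ?thesis using x by (intro continuous_intros) auto
  qed
qed

text \<open>
  The first factor is unbounded near \<open>x = 0\<close>. Moving a small power \<open>y = x^e\<close> of \<open>x\<close> from the second
  factor into the first replaces \<open>- ln x\<close> by the bounded function \<open>- (y ln y) / e\<close>. The choice
  \<open>e = 1 / (2 (1 + |s|))\<close> depends continuously on \<open>s\<close> and costs the exponent of \<open>x\<close> at most \<open>1/2\<close>,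
  which is why \<open>Re v > 3/2\<close> is asked for.
\<close>
lemma continuous_on_mellin_weight:
  "continuous_on {(s, v, x). Re s > 1 \<and> Re v > 3/2 \<and> x \<in> {0..1}} (\<lambda>(s, v, x). mellin_weight s v x)"
proof -
  define A :: "(complex \<times> complex \<times> real) set"
    where "A = {(s, v, x). Re s > 1 \<and> Re v > 3/2 \<and> x \<in> {0..1}}"
  define e where "e s = 1 / (2 * (1 + norm s))" for s :: complex
  have e: "e s > 0" for s using norm_ge_zero[of s] by (auto simp: e_def add_pos_nonneg)
  have le: "e s * (Re s - 1) \<le> 1/2" for s
  proof -
    have "Re s - 1 \<le> 1 + norm s" using complex_Re_le_cmod[of s] by linarith
    then show ?thesis unfolding e_def using norm_ge_zero[of s]
      by (simp add: divide_le_eq add_pos_nonneg)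
  qed
  define y where "y s x = x powr e s" for s and x :: real
  have A: "Re (fst p) > 1" "Re (fst (snd p)) > 3/2" "snd (snd p) \<in> {0..1}" if "p \<in> A" for p
    using that by (auto simp: A_def)
  have conte: "continuous_on UNIV e" unfolding e_def
    by (intro continuous_intros) (metis add_pos_nonneg less_numeral_extra(1,3) mult_eq_0_iff norm_ge_zero zero_neq_numeral)
  have conty: "continuous_on A (\<lambda>(s, v, x). y s x)"
    unfolding y_def split_beta
    by (intro continuous_on_powr' continuous_intros continuous_on_compose2[OF conte]) (use A in \<open>auto intro: e\<close>)
  define b where "b s x = - (y s x * ln (y s x)) / e s" for s x
  have contb: "continuous_on A (\<lambda>(s, v, x). b s x)"
    unfolding b_def
    using conty e
    by (auto simp: split_beta intro!: continuous_intros continuous_on_compose2[OF continuous_on_x_ln_x]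
         continuous_on_compose2[OF conte]) (auto simp: y_def less_imp_neq[OF e, symmetric])
  have eq: "mellin_weight s v x =
      of_real (b s x) powr (s - 1) * of_real x powr (v - 1 - of_real (e s) * (s - 1))"
    if "(s, v, x) \<in> A" for s v x
  proof (cases "x = 0")
    case True
    then show ?thesis by (simp add: mellin_weight_def)
  next
    case False
    with A[OF that] have x: "0 < x" "x \<le> 1" by auto
    have "b s x = y s x * (- ln x)"
      using x e[of s] by (simp add: b_def y_def ln_powr)
    then have "of_real (b s x) powr (s - 1)
        = of_real (y s x) powr (s - 1) * complex_of_real (- ln x) powr (s - 1)"
      using x by (simp only: of_real_mult, intro powr_times_real) (auto simp: y_def)
    also have "of_real (y s x) powr (s - 1) = complex_of_real x powr (of_real (e s) * (s - 1))"
      using x by (simp add: y_def powr_def ln_powr Ln_of_real exp_of_real [symmetric] mult_ac)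
    finally show ?thesis using x
      by (simp add: mellin_weight_def powr_diff mult_ac)
  qed
  have "continuous_on A (\<lambda>(s, v, x). of_real (b s x) powr (s - 1)
      * complex_of_real x powr (v - 1 - of_real (e s) * (s - 1)))"
    unfolding split_beta
  proof (intro continuous_on_mult continuous_on_powr_complex)
    show "continuous_on A (\<lambda>p. complex_of_real (b (fst p) (snd (snd p))))"
      using contb by (intro continuous_intros) (simp add: split_beta)
    have "0 \<le> b s x" if "x \<in> {0..1}" for s x
    proof (cases "x = 0")
      case False
      with that e[of s] show ?thesis
        by (auto simp: b_def y_def ln_powr mult_nonneg_nonpos)
    qed (auto simp: b_def y_def)
    then show "A \<subseteq> {p. 0 \<le> Re (complex_of_real (b (fst p) (snd (snd p)))) \<or>
        Im (complex_of_real (b (fst p) (snd (snd p)))) \<noteq> 0}"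
      using A by auto
    show "continuous_on A (\<lambda>p. fst (snd p) - 1 - complex_of_real (e (fst p)) * (fst p - 1))"
      by (intro continuous_intros continuous_on_compose2[OF conte]) auto
    show "Re (fst (snd p) - 1 - complex_of_real (e (fst p)) * (fst p - 1)) > 0" if "p \<in> A" for p
      using A[OF that] le[of "fst p"] by auto
  qed (use A in \<open>auto intro!: continuous_intros\<close>)
  then show ?thesis
    unfolding A_def[symmetric]
    by (rule continuous_on_eq) (use eq in force)
qed

lemma continuous_on_mellin_weight_compose:
  assumes "continuous_on A s" "continuous_on A v" "continuous_on A x"
    and "\<And>p. p \<in> A \<Longrightarrow> Re (s p) > 1 \<and> Re (v p) > 3/2 \<and> x p \<in> {0..1}"
  shows "continuous_on A (\<lambda>p. mellin_weight (s p) (v p) (x p))"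
proof -
  have "continuous_on A (\<lambda>p. case (s p, v p, x p) of (s, v, x) \<Rightarrow> mellin_weight s v x)"
    by (rule continuous_on_compose2[OF continuous_on_mellin_weight])
      (use assms in \<open>auto intro!: continuous_intros\<close>)
  then show ?thesis by simp
qed

text \<open>The substitution \<open>x = exp (- t / u)\<close> turns the integral into Euler's integral for \<open>\<Gamma>\<close>.\<close>
lemma mellin_weight_has_integral_real:
  fixes s :: complex and u :: real
  assumes s: "Re s > 1" and u: "u > 0"
  shows "(mellin_weight s (of_real u) has_integral Gamma s * of_real u powr (-s)) {0..1}"
proof -
  define g where "g t = exp (- t / u)" for t :: real
  have img: "g ` {0<..} = {0<..<1}"
  proof (intro equalityI subsetI)
    fix x :: real assume x: "x \<in> {0<..<1}"
    then have "x = g (- u * ln x)" "- u * ln x > 0" using u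
      by (auto simp: g_def mult_pos_neg)
    then show "x \<in> g ` {0<..}" by blast
  qed (use u in \<open>auto simp: g_def\<close>)
  have der: "(g has_field_derivative - g t / u) (at t within {0<..})" for t
    unfolding g_def using u by (auto intro!: derivative_eq_intros)
  have inj: "inj_on g {0<..}" using u by (auto simp: g_def inj_on_def)
  have eq: "\<bar>- g t / u\<bar> *\<^sub>R mellin_weight s (of_real u) (g t)
      = of_real u powr (-s) * (of_real t powr (s - 1) / of_real (exp t))" if "t \<in> {0<..}" for t
  proof -
    have t: "t > 0" using that by simp
    have "Ln (of_real t / of_real u) = complex_of_real (ln t - ln u)"
      using Ln_of_real[of "t / u"] t u by (simp add: ln_div)
    then have "mellin_weight s (of_real u) (g t)
        = exp ((s - 1) * of_real (ln t - ln u)) * exp ((of_real u - 1) * of_real (- t / u))"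
      using t u by (simp add: mellin_weight_def g_def powr_def Ln_of_real ln_div)
    then have "\<bar>- g t / u\<bar> *\<^sub>R mellin_weight s (of_real u) (g t) = exp (of_real (- t / u - ln u)) *
        (exp ((s - 1) * of_real (ln t - ln u)) * exp ((of_real u - 1) * of_real (- t / u)))"
    proof -
      have "\<bar>- g t / u\<bar> = exp (- t / u - ln u)"
        using u by (simp add: g_def exp_diff abs_of_pos)
      then show ?thesis using \<open>mellin_weight s (of_real u) (g t) = _\<close>
        by (simp only: scaleR_conv_of_real exp_of_real)
    qed
    also have "\<dots> = exp (of_real (- t / u - ln u) + (s - 1) * of_real (ln t - ln u) + (of_real u - 1) * of_real (- t / u))"
      by (simp only: exp_add mult.assoc)
    also have "of_real (- t / u - ln u) + (s - 1) * of_real (ln t - ln u) + (of_real u - 1) * of_real (- t / u)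
        = - s * of_real (ln u) + ((s - 1) * of_real (ln t) - of_real t)"
      using u by (simp add: field_simps)
    also have "exp \<dots> = of_real u powr (-s) * (of_real t powr (s - 1) / of_real (exp t))"
      using t u by (simp add: powr_def Ln_of_real exp_add exp_diff exp_of_real exp_minus divide_inverse mult_ac)
    finally show ?thesis .
  qed
  have int: "((\<lambda>t. of_real u powr (-s) * (of_real t powr (s - 1) / of_real (exp t)))
      has_integral (of_real u powr (-s) * Gamma s)) {0<..}"
    using Gamma_integral_complex'[of s] s by (intro has_integral_mult_right) auto
  have abs: "(\<lambda>t. of_real u powr (-s) * (of_real t powr (s - 1) / of_real (exp t))) absolutely_integrable_on {0<..}"
    using absolutely_integrable_Gamma_integral'[of s] s by (intro set_integrable_mult_right) auto
  have "(\<lambda>t. \<bar>- g t / u\<bar> *\<^sub>R mellin_weight s (of_real u) (g t)) absolutely_integrable_on {0<..}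
      \<longleftrightarrow> (\<lambda>t. of_real u powr (-s) * (of_real t powr (s - 1) / of_real (exp t))) absolutely_integrable_on {0<..}"
    by (intro set_integrable_cong refl eq)
  moreover have "integral {0<..} (\<lambda>t. \<bar>- g t / u\<bar> *\<^sub>R mellin_weight s (of_real u) (g t))
      = integral {0<..} (\<lambda>t. of_real u powr (-s) * (of_real t powr (s - 1) / of_real (exp t)))"
    by (rule integral_cong) (rule eq)
  ultimately have "(\<lambda>t. \<bar>- g t / u\<bar> *\<^sub>R mellin_weight s (of_real u) (g t)) absolutely_integrable_on {0<..}
      \<and> integral {0<..} (\<lambda>t. \<bar>- g t / u\<bar> *\<^sub>R mellin_weight s (of_real u) (g t)) = of_real u powr (-s) * Gamma s"
    using abs integral_unique[OF int] by argo
  then have "mellin_weight s (of_real u) absolutely_integrable_on {0<..<1}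
      \<and> integral {0<..<1} (mellin_weight s (of_real u)) = of_real u powr (-s) * Gamma s"
    by (subst (asm) has_absolute_integral_change_of_variables_real[OF _ der inj]) (simp_all only: img, simp)
  then have "(mellin_weight s (of_real u) has_integral of_real u powr (-s) * Gamma s) {0<..<1}"
    by (auto simp: absolutely_integrable_on_def has_integral_iff)
  then show ?thesis
    by (simp only: has_integral_Icc_iff_Ioo mult.commute)
qed

text \<open>
  Both sides are holomorphic in \<open>u\<close> and agree for real \<open>u\<close>; the substitution used there is not available
  for complex \<open>u\<close>.
\<close>
lemma mellin_weight_has_integral:
  assumes s: "Re s > 1" and u: "Re u > 3/2"
  shows "(mellin_weight s u has_integral Gamma s * u powr (-s)) {0..1}"
proof -
  define S where "S = {u. Re u > 3/2}"
  have S: "open S" "connected S" unfolding S_def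
    by (rule open_halfspace_Re_gt, intro convex_connected convex_halfspace_Re_gt)
  have cont: "continuous_on (S \<times> {0..1}) (\<lambda>(u, x). mellin_weight s u x)"
    unfolding split_beta using s
    by (intro continuous_on_mellin_weight_compose continuous_intros) (auto simp: S_def)
  have hol: "(\<lambda>u. integral {0..1} (mellin_weight s u)) holomorphic_on S"
    by (rule holomorphic_on_integral_param[OF S(1) cont])
      (auto simp: mellin_weight_def intro!: holomorphic_intros)
  have "u \<in> S" using u by (simp add: S_def)
  have ne: "u \<notin> \<real>\<^sub>\<le>\<^sub>0" if "u \<in> S" for u using that by (auto simp: S_def complex_nonpos_Reals_iff)
  have "integral {0..1} (mellin_weight s u) - Gamma s * u powr (-s) = 0"
  proof (rule analytic_continuation[of "\<lambda>u. integral {0..1} (mellin_weight s u) - Gamma s * u powr (-s)" S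
        "closed_segment 2 3" 2])
    have "closed_segment 2 3 \<noteq> {x}" for x :: complex
    proof
      assume *: "closed_segment 2 3 = {x}"
      have "2 \<in> {x}" "3 \<in> {x}" unfolding *[symmetric] by auto
      then show False by simp
    qed
    then show "(2 :: complex) islimpt closed_segment 2 3"
      by (intro connected_imp_perfect) auto
    show "closed_segment 2 3 \<subseteq> S"
      using convex_halfspace_Re_gt[of "3/2"] by (intro closed_segment_subset) (auto simp: S_def)
    show "integral {0..1} (mellin_weight s w) - Gamma s * w powr (-s) = 0" if w: "w \<in> closed_segment 2 3" for w
    proof -
      have "w = of_real (Re w)" "Re w > 0" using w
        by (auto simp: closed_segment_def complex_eq_iff algebra_simps)
      with mellin_weight_has_integral_real[OF s, of "Re w"] show ?thesis
        by (metis integral_unique right_minus_eq)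
    qed
    show "(\<lambda>u. integral {0..1} (mellin_weight s u) - Gamma s * u powr (-s)) holomorphic_on S"
      by (intro holomorphic_intros hol) (use ne in auto)
  qed (use S \<open>u \<in> S\<close> in \<open>auto simp: S_def\<close>)
  moreover have "mellin_weight s u integrable_on {0..1}"
    using s u by (intro integrable_continuous_interval continuous_on_mellin_weight_compose continuous_intros) auto
  ultimately show ?thesis by (simp add: has_integral_iff)
qed

lemma mellin_weight_shift:
  "mellin_weight s (of_nat j + v) x = of_real x ^ j * mellin_weight s v x"
proof (cases "x = 0")
  case False
  then have "of_real x powr (of_nat j + v - 1) = (of_real x ^ j * of_real x powr (v - 1) :: complex)"
    using powr_add[of "of_real x :: complex" "of_nat j" "v - 1"] by (simp add: algebra_simps)
  then show ?thesis by (simp add: mellin_weight_def)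
qed (simp add: mellin_weight_def)

section \<open>The slit plane\<close>

lemma lerch_cut_eq: "lerch_cut = {z. Im z = 0 \<and> Re z \<ge> 1}"
  by (auto simp: lerch_cut_def complex_eq_iff image_iff intro: bexI[of _ "Re _"])

lemma open_Compl_lerch_cut: "open (- lerch_cut)"
  unfolding lerch_cut_eq
  by (intro open_Compl closed_Collect_conj closed_Collect_eq closed_Collect_le continuous_intros)

lemma ball_subset_Compl_lerch_cut: "ball 0 1 \<subseteq> - lerch_cut"
proof
  fix z :: complex assume "z \<in> ball 0 1"
  then have "Re z < 1" using complex_Re_le_cmod[of z] by simp
  then show "z \<in> - lerch_cut" by (simp add: lerch_cut_eq)
qed

text \<open>The slit plane is star-shaped with respect to the origin.\<close>
lemma scale_notin_lerch_cut:
  assumes "z \<notin> lerch_cut" "x \<in> {0..1}"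
  shows "z * of_real x \<notin> lerch_cut"
proof
  assume "z * of_real x \<in> lerch_cut"
  then have *: "Im z = 0 \<or> x = 0" "Re z * x \<ge> 1" by (auto simp: lerch_cut_eq)
  then have "x \<noteq> 0" by auto
  have "Re z \<ge> 0"
  proof (rule ccontr)
    assume "\<not> Re z \<ge> 0"
    then have "Re z * x \<le> 0" using assms(2) by (intro mult_nonpos_nonneg) auto
    with * show False by simp
  qed
  then have "Re z * x \<le> Re z * 1" using assms(2) by (intro mult_left_mono) auto
  with * \<open>x \<noteq> 0\<close> assms(1) show False by (auto simp: lerch_cut_eq)
qed

lemma connected_Compl_lerch_cut: "connected (- lerch_cut)"
proof (rule starlike_imp_connected)
  show "starlike (- lerch_cut)"
    unfolding starlike_def
  proof (intro bexI ballI subsetI)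
    fix z w assume z: "z \<in> - lerch_cut" and w: "w \<in> closed_segment 0 z"
    then obtain x where "x \<in> {0..1}" "w = z * of_real x"
      by (auto simp: closed_segment_def scaleR_conv_of_real mult.commute)
    with z scale_notin_lerch_cut show "w \<in> - lerch_cut" by auto
  qed (auto simp: lerch_cut_eq)
qed

section \<open>Integral representation of the Lerch series\<close>

text \<open>
  The \<open>m\<close>-th power of the Euler operator \<open>v + y d/dy\<close> applied to \<open>1 / (1 - y)\<close>. The operator multiplies
  the coefficient of \<open>y^j\<close> by \<open>j + v\<close>.
\<close>
fun lerch_kernel :: "complex \<Rightarrow> nat \<Rightarrow> complex \<Rightarrow> complex" where
  "lerch_kernel v 0 y = 1 / (1 - y)"
| "lerch_kernel v (Suc m) y = v * lerch_kernel v m y + y * deriv (lerch_kernel v m) y"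

lemma holomorphic_lerch_kernel: "lerch_kernel v m holomorphic_on - lerch_cut"
proof (induction m)
  case 0
  have "1 - y \<noteq> 0" if "y \<in> - lerch_cut" for y using that by (auto simp: lerch_cut_eq)
  then have "(\<lambda>y. 1 / (1 - y)) holomorphic_on - lerch_cut" by (intro holomorphic_intros) auto
  then show ?case by simp
next
  case (Suc m)
  then have "(\<lambda>y. v * lerch_kernel v m y + y * deriv (lerch_kernel v m) y) holomorphic_on - lerch_cut"
    by (intro holomorphic_intros open_Compl_lerch_cut)
  then show ?case by simp
qed

lemma lerch_kernel_sums:
  "norm y < 1 \<Longrightarrow> (\<lambda>j. (of_nat j + v) ^ m * y ^ j) sums lerch_kernel v m y"
proof (induction m arbitrary: y)
  case 0
  then show ?case using geometric_sums[of y] by simp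
next
  case (Suc m)
  have "y \<in> - lerch_cut" using Suc.prems ball_subset_Compl_lerch_cut by auto
  then have "(lerch_kernel v m has_field_derivative deriv (lerch_kernel v m) y) (at y)"
    using holomorphic_derivI[OF holomorphic_lerch_kernel open_Compl_lerch_cut] by blast
  from termdiffs_sums_strong[OF Suc.IH this Suc.prems]
  have "(\<lambda>j. y * (diffs (\<lambda>j. (of_nat j + v) ^ m) j * y ^ j)) sums (y * deriv (lerch_kernel v m) y)"
    by (intro sums_mult) simp
  also have "(\<lambda>j. y * (diffs (\<lambda>j. (of_nat j + v) ^ m) j * y ^ j))
      = (\<lambda>j. of_nat (Suc j) * (of_nat (Suc j) + v) ^ m * y ^ Suc j)"
    by (simp add: diffs_def mult_ac fun_eq_iff)
  finally have "(\<lambda>j. of_nat j * (of_nat j + v) ^ m * y ^ j) sums (y * deriv (lerch_kernel v m) y)"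
    by (subst (asm) sums_Suc_iff) simp
  from sums_add[OF sums_mult[OF Suc.IH[OF Suc.prems], of v] this] show ?case
    by (simp add: algebra_simps)
qed

text \<open>
  For \<open>Re s > 1 - m\<close> the weight with exponent \<open>s + m\<close> is integrable, and the \<open>m\<close> extra factors \<open>j + v\<close>
  in the kernel undo the shift of \<open>s\<close>. The reciprocal Gamma function is entire, so that no poles have
  to be excluded.
\<close>
definition lerch_mellin :: "complex \<Rightarrow> nat \<Rightarrow> complex \<Rightarrow> complex \<Rightarrow> complex" where
  "lerch_mellin v m z s = rGamma (s + of_nat m) *
     integral {0..1} (\<lambda>x. mellin_weight (s + of_nat m) v x * lerch_kernel v m (z * of_real x))"

lemma continuous_on_lerch_kernel_compose:
  assumes "continuous_on A f" "continuous_on A x"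
    and "\<And>p. p \<in> A \<Longrightarrow> f p \<notin> lerch_cut \<and> x p \<in> {0..1}"
  shows "continuous_on A (\<lambda>p. lerch_kernel v m (f p * of_real (x p)))"
  by (rule continuous_on_compose2[OF holomorphic_on_imp_continuous_on[OF holomorphic_lerch_kernel]])
    (use assms scale_notin_lerch_cut in \<open>auto intro!: continuous_intros\<close>)

lemma holomorphic_lerch_mellin:
  assumes v: "Re v > 3/2" and s: "Re s > 1 - real m"
  shows "(\<lambda>z. lerch_mellin v m z s) holomorphic_on - lerch_cut"
proof -
  have "(\<lambda>z. integral {0..1} (\<lambda>x. mellin_weight (s + of_nat m) v x * lerch_kernel v m (z * of_real x)))
      holomorphic_on - lerch_cut"
  proof (rule holomorphic_on_integral_param[OF open_Compl_lerch_cut])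
    show "continuous_on ((- lerch_cut) \<times> {0..1})
        (\<lambda>(z, x). mellin_weight (s + of_nat m) v x * lerch_kernel v m (z * of_real x))"
      unfolding split_beta using v s
      by (intro continuous_intros continuous_on_mellin_weight_compose continuous_on_lerch_kernel_compose) auto
    show "(\<lambda>z. mellin_weight (s + of_nat m) v x * lerch_kernel v m (z * of_real x)) holomorphic_on - lerch_cut"
      if "x \<in> {0..1}" for x
      by (intro holomorphic_intros holomorphic_on_compose_gen[OF _ holomorphic_lerch_kernel, unfolded o_def])
        (use that scale_notin_lerch_cut in auto)
  qed
  then show ?thesis unfolding lerch_mellin_def by (intro holomorphic_intros)
qed

lemma holomorphic_lerch_mellin_exponent:
  assumes v: "Re v > 3/2" and z: "z \<notin> lerch_cut"
  shows "lerch_mellin v m z holomorphic_on {s. Re s > 1 - real m}"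
proof -
  have "(\<lambda>s. integral {0..1} (\<lambda>x. mellin_weight (s + of_nat m) v x * lerch_kernel v m (z * of_real x)))
      holomorphic_on {s. Re s > 1 - real m}"
  proof (rule holomorphic_on_integral_param)
    show "continuous_on ({s. Re s > 1 - real m} \<times> {0..1})
        (\<lambda>(s, x). mellin_weight (s + of_nat m) v x * lerch_kernel v m (z * of_real x))"
      unfolding split_beta using v z
      by (intro continuous_intros continuous_on_mellin_weight_compose continuous_on_lerch_kernel_compose) auto
  qed (auto simp: mellin_weight_def open_halfspace_Re_gt intro!: holomorphic_intros)
  then show ?thesis unfolding lerch_mellin_def[abs_def] by (intro holomorphic_intros)
qed

text \<open>
  Expand the kernel into its power series and integrate term by term; each term is a moment of the
  weight.
\<close>
lemma lerch_term_sums_lerch_mellin: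
  assumes v: "Re v > 3/2" and s: "Re s > 1 - real m" and z: "norm z < 1"
  shows "lerch_term z s v sums lerch_mellin v m z s"
proof -
  define w where "w = mellin_weight (s + of_nat m) v"
  define f where "f j x = (of_nat j + v) ^ m * z ^ j * mellin_weight (s + of_nat m) (of_nat j + v) x" for j x
  have f: "f j x = w x * ((of_nat j + v) ^ m * (z * of_real x) ^ j)" for j x
    by (simp add: f_def w_def mellin_weight_shift power_mult_distrib)
  have contw: "continuous_on {0..1} w"
    unfolding w_def using v s by (intro continuous_on_mellin_weight_compose continuous_intros) auto
  then have "compact (w ` {0..1})" by (intro compact_continuous_image) auto
  then obtain B where B: "\<And>x. x \<in> {0..1} \<Longrightarrow> norm (w x) \<le> B"
    using compact_imp_bounded[of "w ` {0..1}"] by (force simp: bounded_iff)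
  have B0: "B \<ge> 0" using order_trans[OF norm_ge_zero B[of 0]] by simp
  obtain r where r: "norm z < r" "r < 1" using z dense by blast
  moreover have "r > 0" using r norm_ge_zero[of z] by linarith
  ultimately have "norm (of_real r :: complex) < 1" by simp
  from sums_summable[OF lerch_kernel_sums[OF this]]
  have "summable (\<lambda>j. norm ((of_nat j + v) ^ m * z ^ j))"
    by (rule powser_insidea) (use r norm_ge_zero[of z] in simp)
  then have sumM: "summable (\<lambda>j. B * norm ((of_nat j + v) ^ m * z ^ j))" by (rule summable_mult)
  have bound: "norm (f j x) \<le> B * norm ((of_nat j + v) ^ m * z ^ j)" if x: "x \<in> {0..1}" for j x
  proof -
    have "norm (f j x) = norm (w x) * (norm ((of_nat j + v) ^ m * z ^ j) * x ^ j)"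
      using x by (simp add: f norm_mult norm_power power_mult_distrib)
    also have "\<dots> \<le> B * (norm ((of_nat j + v) ^ m * z ^ j) * 1)"
      using x B[OF x] B0 by (intro mult_mono power_le_one) auto
    finally show ?thesis by simp
  qed
  have contf: "continuous_on {0..1} (f j)" for j
    unfolding f by (intro continuous_intros contw)
  have sum: "(\<Sum>j. f j x) = w x * lerch_kernel v m (z * of_real x)" if x: "x \<in> {0..1}" for x
  proof -
    have "norm (z * of_real x) < 1"
      using x z mult_mono[of "norm z" "norm z" x 1] by (auto simp: norm_mult)
    from sums_mult[OF lerch_kernel_sums[OF this], of "w x"] show ?thesis
      unfolding f by (simp add: sums_iff)
  qed
  have int: "integral {0..1} (f j) = Gamma (s + of_nat m) * lerch_term z s v j" for j
  proof -
    have v': "Re (of_nat j + v) > 3/2" using v by simp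
    then have nz: "of_nat j + v \<noteq> 0" by (metis zero_complex.sel(1) not_less_iff_gr_or_eq zero_less_divide_iff zero_less_numeral order.strict_trans)
    have "Re (s + of_nat m) > 1" using s by simp
    from mellin_weight_has_integral[OF this v']
    have "integral {0..1} (f j) = (of_nat j + v) ^ m * z ^ j * (Gamma (s + of_nat m) * (of_nat j + v) powr (- (s + of_nat m)))"
      unfolding f_def by (simp add: integral_unique)
    also have "(of_nat j + v) powr (- (s + of_nat m)) = 1 / ((of_nat j + v) powr s * (of_nat j + v) ^ m)"
      unfolding powr_minus powr_add using nz by (simp add: field_simps)
    finally show ?thesis using nz by (simp add: lerch_term_def)
  qed
  have "(\<lambda>j. integral {0..1} (f j)) sums integral {0..1} (\<lambda>x. \<Sum>j. f j x)"
    by (rule integral_sums_M_test[OF contf _ sumM]) (simp add: bound)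
  also have "integral {0..1} (\<lambda>x. \<Sum>j. f j x) = integral {0..1} (\<lambda>x. w x * lerch_kernel v m (z * of_real x))"
    by (intro integral_cong sum)
  finally have "(\<lambda>j. rGamma (s + of_nat m) * (Gamma (s + of_nat m) * lerch_term z s v j)) sums
      (rGamma (s + of_nat m) * integral {0..1} (\<lambda>x. w x * lerch_kernel v m (z * of_real x)))"
    unfolding int by (intro sums_mult)
  moreover have "rGamma (s + of_nat m) * Gamma (s + of_nat m) = 1"
  proof -
    have "s + of_nat m \<notin> \<int>\<^sub>\<le>\<^sub>0" using s by (auto elim!: nonpos_Ints_cases simp: complex_eq_iff)
    then show ?thesis by (simp add: rGamma_inverse_Gamma Gamma_eq_zero_iff)
  qed
  ultimately show ?thesis
    unfolding lerch_mellin_def w_def by (simp add: mult.assoc[symmetric])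
qed

section \<open>Continuation in z to the slit plane\<close>

lemma lerch_term_eq: "lerch_term z s v j = z ^ j * (of_nat j + v) powr (-s)"
  by (simp add: lerch_term_def powr_minus divide_inverse)

lemma lerch_term_shift: "lerch_term z s v (j + N) = z ^ N * lerch_term z s (v + of_nat N) j"
  by (simp add: lerch_term_eq power_add algebra_simps)

text \<open>
  Splitting off finitely many terms replaces \<open>v\<close> by \<open>v + N\<close>, so everything reduces to parameters \<open>v\<close> of
  large real part.
\<close>
lemma lerch_term_sums_shift:
  assumes "lerch_term z s (v + of_nat N) sums a"
  shows "lerch_term z s v sums ((\<Sum>j<N. lerch_term z s v j) + z ^ N * a)"
  using sums_mult[OF assms, of "z ^ N"]
  by (subst (asm) lerch_term_shift[symmetric], subst (asm) sums_iff_shift) (simp add: add.commute)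

lemma exists_shift: "\<exists>N. Re (v + of_nat N) > x"
  using reals_Archimedean2[of "x - Re v"] by (auto simp: algebra_simps)

lemma UN_half_planes: "(\<Union>m::nat. {s. Re s > 1 - real m}) = UNIV"
proof -
  have "\<exists>m::nat. Re s > 1 - real m" for s
    using reals_Archimedean2[of "1 - Re s"] by (auto simp: algebra_simps)
  then show ?thesis by auto
qed

lemma lerch_continuation_exists:
  "\<exists>f. f holomorphic_on (- lerch_cut) \<and> (\<forall>z\<in>ball 0 1. lerch_term z s v sums f z)"
proof -
  obtain N where N: "Re (v + of_nat N) > 3/2" using exists_shift by blast
  obtain m :: nat where m: "Re s > 1 - real m"
    using reals_Archimedean2[of "1 - Re s"] by (auto simp: algebra_simps)
  have "(\<lambda>z. (\<Sum>j<N. lerch_term z s v j) + z ^ N * lerch_mellin (v + of_nat N) m z s) holomorphic_on - lerch_cut"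
    unfolding lerch_term_eq by (intro holomorphic_intros holomorphic_lerch_mellin N m)
  moreover have "lerch_term z s v sums ((\<Sum>j<N. lerch_term z s v j) + z ^ N * lerch_mellin (v + of_nat N) m z s)"
    if "z \<in> ball 0 1" for z
    using that by (intro lerch_term_sums_shift lerch_term_sums_lerch_mellin N m) auto
  ultimately show ?thesis by blast
qed

lemma holomorphic_lerch_phi_continuation:
    "lerch_phi_continuation s v holomorphic_on (- lerch_cut)"
  and lerch_term_sums_lerch_phi_continuation:
    "norm z < 1 \<Longrightarrow> lerch_term z s v sums lerch_phi_continuation s v z"
  using someI_ex[OF lerch_continuation_exists[of s v]] by (auto simp: lerch_phi_continuation_def)

lemma lerch_phi_continuation_unique:
  assumes "f holomorphic_on - lerch_cut" "\<And>z. norm z < 1 \<Longrightarrow> lerch_term z s v sums f z" "z \<notin> lerch_cut"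
  shows "lerch_phi_continuation s v z = f z"
proof (rule analytic_continuation_open[of "ball 0 1" "- lerch_cut" "lerch_phi_continuation s v" f])
  show "lerch_phi_continuation s v w = f w" if "w \<in> ball 0 1" for w
    using that assms(2)[of w] lerch_term_sums_lerch_phi_continuation[of w s v] sums_unique2 by auto
qed (use assms open_Compl_lerch_cut connected_Compl_lerch_cut ball_subset_Compl_lerch_cut
      holomorphic_lerch_phi_continuation in auto)

text \<open>
  The continuation is chosen for each \<open>s\<close> separately, so it must first be identified, on each half plane
  \<open>Re s > 1 - m\<close>, with the integral representation, which is holomorphic in \<open>s\<close>.
\<close>
lemma holomorphic_lerch_phi_continuation_exponent:
  assumes z: "z \<notin> lerch_cut"
  shows "(\<lambda>s. lerch_phi_continuation s v z) holomorphic_on UNIV"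
proof -
  obtain N where N: "Re (v + of_nat N) > 3/2" using exists_shift by blast
  have "(\<lambda>s. lerch_phi_continuation s v z) holomorphic_on {s. Re s > 1 - real m}" for m
  proof -
    have eq: "lerch_phi_continuation s v z
        = (\<Sum>j<N. lerch_term z s v j) + z ^ N * lerch_mellin (v + of_nat N) m z s"
      if s: "Re s > 1 - real m" for s
    proof (rule lerch_phi_continuation_unique[OF _ _ z])
      show "(\<lambda>z. (\<Sum>j<N. lerch_term z s v j) + z ^ N * lerch_mellin (v + of_nat N) m z s) holomorphic_on - lerch_cut"
        unfolding lerch_term_eq by (intro holomorphic_intros holomorphic_lerch_mellin N s)
      show "lerch_term z s v sums ((\<Sum>j<N. lerch_term z s v j) + z ^ N * lerch_mellin (v + of_nat N) m z s)"
        if "norm z < 1" for z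
        using that by (intro lerch_term_sums_shift lerch_term_sums_lerch_mellin N s)
    qed
    have "(\<lambda>s. (\<Sum>j<N. lerch_term z s v j) + z ^ N * lerch_mellin (v + of_nat N) m z s)
        holomorphic_on {s. Re s > 1 - real m}"
      unfolding lerch_term_eq
      by (intro holomorphic_intros holomorphic_lerch_mellin_exponent[OF N z])
    then show ?thesis by (rule holomorphic_transform) (simp add: eq)
  qed
  then have "(\<lambda>s. lerch_phi_continuation s v z) holomorphic_on (\<Union>m. {s. Re s > 1 - real m})"
    by (intro holomorphic_on_UN_open open_halfspace_Re_gt) auto
  then show ?thesis by (simp only: UN_half_planes)
qed

section \<open>Absolute convergence and boundary values\<close>

text \<open>
  The factor \<open>exp (\<pi> B)\<close> bounds the contribution of the argument of \<open>j + v\<close> to the modulus of a complex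
  power. The bound is uniform in \<open>v\<close> and locally uniform in \<open>s\<close>.
\<close>
lemma norm_lerch_term_le:
  assumes v: "Re v \<ge> 0" and s: "c \<le> Re s" "0 \<le> c" "\<bar>Im s\<bar> \<le> B" and z: "norm z \<le> 1" and j: "j \<ge> 1"
  shows "norm (lerch_term z s v j) \<le> exp (pi * B) * real j powr (- c)"
proof -
  have j1: "real j \<le> norm (of_nat j + v)"
    using complex_Re_le_cmod[of "of_nat j + v"] v by simp
  have "norm ((of_nat j + v) powr (-s)) = norm (of_nat j + v) powr (- Re s) * exp (Im s * Arg (of_nat j + v))"
    by (simp add: norm_powr_complex)
  also have "norm (of_nat j + v) powr (- Re s) \<le> norm (of_nat j + v) powr (- c)"
    using j1 j s by (intro powr_mono) auto
  also have "\<dots> \<le> real j powr (- c)" using j1 j s by (intro powr_mono2') auto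
  also have "Im s * Arg (of_nat j + v) \<le> \<bar>Im s\<bar> * \<bar>Arg (of_nat j + v)\<bar>"
    by (metis abs_ge_self abs_mult)
  also have "\<dots> \<le> B * pi"
    using s Arg_bounded[of "of_nat j + v"] by (intro mult_mono) auto
  finally have "norm ((of_nat j + v) powr (-s)) \<le> real j powr (- c) * exp (B * pi)"
    by (simp add: mult_mono)
  moreover have "norm z ^ j \<le> 1" using z by (simp add: power_le_one)
  ultimately have "norm z ^ j * norm ((of_nat j + v) powr (-s)) \<le> 1 * (real j powr (- c) * exp (B * pi))"
    by (intro mult_mono) auto
  then show ?thesis by (simp add: lerch_term_eq norm_mult norm_power mult_ac)
qed

lemma summable_norm_lerch_term:
  assumes s: "Re s > 1" and z: "norm z \<le> 1"
  shows "summable (\<lambda>j. norm (lerch_term z s v j))"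
proof -
  obtain N where N: "Re (v + of_nat N) > 0" using exists_shift by blast
  have "summable (\<lambda>j. norm (lerch_term z s (v + of_nat N) j))"
  proof (rule summable_comparison_test_ev)
    show "eventually (\<lambda>j. norm (norm (lerch_term z s (v + of_nat N) j))
        \<le> exp (pi * \<bar>Im s\<bar>) * real j powr (- Re s)) sequentially"
      using eventually_ge_at_top[of 1]
      by eventually_elim (use norm_lerch_term_le N s z in auto)
    show "summable (\<lambda>j. exp (pi * \<bar>Im s\<bar>) * real j powr (- Re s))"
      using s by (intro summable_mult) (simp add: summable_real_powr_iff)
  qed
  from summable_mult[OF this, of "norm z ^ N"]
  have "summable (\<lambda>j. norm (lerch_term z s v (j + N)))"
    by (simp only: lerch_term_shift norm_mult norm_power)
  then show ?thesis
    using summable_iff_shift[of "\<lambda>j. norm (lerch_term z s v j)" N] by blast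
qed

text \<open>
  On the radius towards \<open>z\<close> both the series and the continuation are continuous up to the end point, and
  they agree before it.
\<close>
lemma lerch_term_sums_lerch_phi_continuation_closed_disc:
  assumes s: "Re s > 1" and z: "norm z \<le> 1" "z \<notin> lerch_cut"
  shows "lerch_term z s v sums lerch_phi_continuation s v z"
proof -
  define g where "g t = (\<Sum>j. lerch_term (z * of_real t) s v j)" for t
  define h where "h t = lerch_phi_continuation s v (z * of_real t)" for t
  have scale: "lerch_term (z * of_real t) s v j = of_real (t ^ j) * lerch_term z s v j" for t j
    by (simp add: lerch_term_eq power_mult_distrib)
  have "continuous_on {0..1} g"
  proof (rule uniform_limit_theorem)
    show "uniform_limit {0..1} (\<lambda>n t. \<Sum>j<n. lerch_term (z * of_real t) s v j) g sequentially"
      unfolding g_def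
    proof (rule Weierstrass_m_test)
      show "norm (lerch_term (z * of_real t) s v j) \<le> norm (lerch_term z s v j)" if "t \<in> {0..1}" for t j
        using that by (auto simp: scale norm_mult norm_power intro!: mult_left_le_one_le power_le_one)
    qed (rule summable_norm_lerch_term[OF s z(1)])
    show "\<forall>\<^sub>F n in sequentially. continuous_on {0..1} (\<lambda>t. \<Sum>j<n. lerch_term (z * of_real t) s v j)"
      unfolding scale by (intro always_eventually allI continuous_intros)
  qed auto
  moreover have "continuous_on {0..1} h"
    unfolding h_def
    by (rule continuous_on_compose2[OF holomorphic_on_imp_continuous_on[OF holomorphic_lerch_phi_continuation]])
      (use z scale_notin_lerch_cut in \<open>auto intro!: continuous_intros\<close>)
  ultimately have cont: "continuous_on (closure {0..<1::real}) (\<lambda>t. g t - h t)"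
    by (auto intro!: continuous_intros)
  have "g t - h t = 0" if "t \<in> {0..<1}" for t
  proof -
    have "norm z * t \<le> 1 * t" using z that by (intro mult_right_mono) auto
    then have "norm (z * of_real t) < 1" using that by (simp add: norm_mult)
    from lerch_term_sums_lerch_phi_continuation[OF this] show ?thesis
      by (simp add: g_def h_def sums_iff)
  qed
  from continuous_constant_on_closure[OF cont this, of 1] have "g 1 = h 1" by simp
  then show ?thesis
    using summable_norm_cancel[OF summable_norm_lerch_term[OF s z(1), of v]]
    by (simp add: g_def h_def sums_iff)
qed

lemma lerch_phi_eq_continuation:
  assumes "z \<notin> lerch_cut"
  shows "lerch_phi z s v = lerch_phi_continuation s v z"
proof -
  have "z \<noteq> 1" using assms by (auto simp: lerch_cut_eq)
  then show ?thesis
    using assms lerch_term_sums_lerch_phi_continuation[of z s v]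
      lerch_term_sums_lerch_phi_continuation_closed_disc[of s z v]
    by (auto simp: lerch_phi_def sums_iff)
qed

lemma lerch_term_sums_lerch_phi:
  assumes "Re s > 1" "norm z \<le> 1"
  shows "lerch_term z s v sums lerch_phi z s v"
  using summable_norm_cancel[OF summable_norm_lerch_term[OF assms, of v]] assms
  by (auto simp: lerch_phi_def intro: summable_sums)

section \<open>Continuation in s of the Hurwitz zeta function\<close>

text \<open>
  These sets exhaust the half plane \<open>Re s > 1\<close>, and on each of them the Hurwitz series converges
  uniformly: \<open>Re s\<close> stays away from 1 and \<open>Im s\<close> stays bounded.
\<close>
definition strip :: "nat \<Rightarrow> complex set" where
  "strip n = {s. Re s > 1 + 1 / real (Suc n) \<and> \<bar>Im s\<bar> < real n}"

lemma open_strip: "open (strip n)"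
  unfolding strip_def by (intro open_Collect_conj open_Collect_less continuous_intros)

lemma UN_strip: "(\<Union>n. strip n) = {s. Re s > 1}"
proof (intro equalityI subsetI)
  fix s assume s: "s \<in> {s. Re s > 1}"
  obtain n1 where n1: "1 / real (Suc n1) < Re s - 1"
    using s reals_Archimedean[of "Re s - 1"] by (auto simp: inverse_eq_divide)
  obtain n2 where n2: "\<bar>Im s\<bar> < real n2" using reals_Archimedean2 by blast
  have "1 / real (Suc (max n1 n2)) \<le> 1 / real (Suc n1)" by (intro divide_left_mono) auto
  with n1 n2 have "s \<in> strip (max n1 n2)" by (auto simp: strip_def)
  then show "s \<in> (\<Union>n. strip n)" by blast
next
  fix s assume "s \<in> (\<Union>n. strip n)"
  then obtain n where "Re s > 1 + 1 / real (Suc n)" by (auto simp: strip_def)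
  moreover have "1 / real (Suc n) > 0" by simp
  ultimately have "Re s > 1" by linarith
  then show "s \<in> {s. Re s > 1}" by simp
qed

lemma hurwitz_series_uniform_limit:
  "uniform_limit (strip n \<times> {v. Re v > 0}) (\<lambda>N (s, v). \<Sum>j<N. lerch_term 1 s v j)
     (\<lambda>(s, v). \<Sum>j. lerch_term 1 s v j) sequentially"
  unfolding split_beta
proof (rule Weierstrass_m_test_ev)
  show "\<forall>\<^sub>F j in sequentially. \<forall>p\<in>strip n \<times> {v. Re v > 0}.
      norm (lerch_term 1 (fst p) (snd p) j) \<le> exp (pi * real n) * real j powr (- (1 + 1 / real (Suc n)))"
    using eventually_ge_at_top[of 1]
  proof eventually_elim
    case (elim j)
    then show ?case by (intro ballI norm_lerch_term_le) (auto simp: strip_def)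
  qed
  have "1 / real (Suc n) > 0" by simp
  then show "summable (\<lambda>j. exp (pi * real n) * real j powr (- (1 + 1 / real (Suc n))))"
    by (intro summable_mult) (simp add: summable_real_powr_iff del: of_nat_Suc)
qed

lemma continuous_on_lerch_term:
  "continuous_on (S \<times> {v. Re v > 0}) (\<lambda>(s, v). lerch_term z s v j)"
  unfolding lerch_term_eq split_beta
  by (intro continuous_intros) (auto simp: complex_eq_iff)

lemma continuous_on_hurwitz_series:
  "continuous_on ({s. Re s > 1} \<times> {v. Re v > 0}) (\<lambda>(s, v). \<Sum>j. lerch_term 1 s v j)"
proof -
  have "continuous_on (\<Union>n\<in>UNIV. strip n \<times> {v. Re v > 0}) (\<lambda>(s, v). \<Sum>j. lerch_term 1 s v j)"
  proof (rule continuous_on_open_UN)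
    fix n
    show "open (strip n \<times> {v. Re v > 0})"
      by (intro open_Times open_strip open_halfspace_Re_gt)
    show "continuous_on (strip n \<times> {v. Re v > 0}) (\<lambda>(s, v). \<Sum>j. lerch_term 1 s v j)"
    proof (rule uniform_limit_theorem[OF _ hurwitz_series_uniform_limit])
      show "\<forall>\<^sub>F N in sequentially. continuous_on (strip n \<times> {v. Re v > 0}) (\<lambda>(s, v). \<Sum>j<N. lerch_term 1 s v j)"
        using continuous_on_lerch_term unfolding split_beta
        by (intro always_eventually allI continuous_on_sum) simp
    qed auto
  qed
  also have "(\<Union>n\<in>UNIV. strip n \<times> {v. Re v > 0}) = (\<Union>n. strip n) \<times> {v. Re v > 0}" by blast
  finally show ?thesis by (simp add: UN_strip)
qed

lemma holomorphic_hurwitz_series: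
  assumes v: "Re v > 0"
  shows "(\<lambda>s. \<Sum>j. lerch_term 1 s v j) holomorphic_on {s. Re s > 1}"
proof -
  have "(\<lambda>s. \<Sum>j. lerch_term 1 s v j) holomorphic_on strip n" for n
  proof (rule holomorphic_uniform_sequence[OF open_strip])
    show "(\<lambda>s. \<Sum>j<N. lerch_term 1 s v j) holomorphic_on strip n" for N
      unfolding lerch_term_eq by (intro holomorphic_intros)
    have lim: "uniform_limit (strip n) (\<lambda>N s. \<Sum>j<N. lerch_term 1 s v j) (\<lambda>s. \<Sum>j. lerch_term 1 s v j) sequentially"
      using uniform_limit_compose'[OF hurwitz_series_uniform_limit[of n], of "\<lambda>s. (s, v)" "strip n"] v
      by auto
    fix s assume "s \<in> strip n"
    then obtain d where "d > 0" "cball s d \<subseteq> strip n" using open_strip open_contains_cball by blast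
    with lim show "\<exists>d>0. cball s d \<subseteq> strip n \<and>
        uniform_limit (cball s d) (\<lambda>N s. \<Sum>j<N. lerch_term 1 s v j) (\<lambda>s. \<Sum>j. lerch_term 1 s v j) sequentially"
      using uniform_limit_on_subset by blast
  qed
  then have "(\<lambda>s. \<Sum>j. lerch_term 1 s v j) holomorphic_on (\<Union>n\<in>UNIV. strip n)"
    by (intro holomorphic_on_UN_open open_strip) auto
  then show ?thesis by (simp add: UN_strip)
qed

text \<open>
  Taylor's formula of first order with integral remainder for \<open>w \<mapsto> w powr (1 - s)\<close> from \<open>x\<close> to
  \<open>x + 1\<close>, in the form in which the difference telescopes when \<open>x\<close> runs through \<open>j + v\<close>.
\<close>
lemma integral_powr_remainder:
  fixes s x :: complex
  assumes x: "Re x > 0"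
  shows "(s - 1) * integral {0..1} (\<lambda>u. (1 - of_real u) * (s * (x + of_real u) powr (- (s + 1))))
       = ((x + 1) powr (1 - s) - x powr (1 - s)) + (s - 1) * x powr (-s)"
proof -
  define A where "A w = (x + w) powr (1 - s) - (s - 1) * ((1 - w) * (x + w) powr (-s))" for w
  have "(A has_field_derivative (s - 1) * ((1 - w) * (s * (x + w) powr (- (s + 1))))) (at w)"
    if "Re w \<ge> 0" for w
  proof -
    have xw: "x + w \<notin> \<real>\<^sub>\<le>\<^sub>0" using x that by (auto simp: complex_nonpos_Reals_iff)
    have "(A has_field_derivative (1 - s) * (x + w) powr (1 - s - 1)
        - (s - 1) * ((1 - w) * (- s * (x + w) powr (- s - 1)) + (- 1) * (x + w) powr (- s))) (at w)"
      unfolding A_def using xw by (auto intro!: derivative_eq_intros)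
    moreover have "1 - s - 1 = - s" "- (s + 1) = - s - 1" by simp_all
    ultimately show ?thesis by (elim DERIV_cong) (simp only:, simp add: algebra_simps)
  qed
  then have "((\<lambda>u. (s - 1) * ((1 - of_real u) * (s * (x + of_real u) powr (- (s + 1)))))
      has_integral A (of_real 1) - A (of_real 0)) {0..1}"
    by (intro fundamental_theorem_of_calculus has_vector_derivative_real_field) auto
  then have "integral {0..1} (\<lambda>u. (s - 1) * ((1 - of_real u) * (s * (x + of_real u) powr (- (s + 1))))) = A (of_real 1) - A (of_real 0)"
    by (rule integral_unique)
  then show ?thesis by (simp add: A_def)
qed

text \<open>
  Sum the previous lemma over \<open>x = j + v\<close>: the differences telescope to \<open>- v powr (1 - s)\<close> and the
  remainders add up to an integral of the series at \<open>s + 1\<close>. The right-hand side therefore makes sense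
  on a half plane that is larger by one unit.
\<close>
lemma hurwitz_series_recursion:
  assumes s: "Re s > 1" and v: "Re v > 0"
  shows "(s - 1) * (\<Sum>j. lerch_term 1 s v j) = v powr (1 - s) +
     (s - 1) * integral {0..1} (\<lambda>u. (1 - of_real u) * (s * (\<Sum>j. lerch_term 1 (s + 1) (v + of_real u) j)))"
proof -
  define f where "f j u = (1 - of_real u) * (s * lerch_term 1 (s + 1) (v + of_real u) j)" for j and u :: real
  define M where "M j = norm s * (exp (pi * \<bar>Im s\<bar>) * real j powr (- (Re s + 1)))" for j
  have contf: "continuous_on {0..1} (f j)" for j
    unfolding f_def lerch_term_eq using v
    by (intro continuous_intros) (auto simp: complex_eq_iff)
  have "\<forall>\<^sub>F j in sequentially. \<forall>u\<in>{0..1}. norm (f j u) \<le> M j"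
    using eventually_ge_at_top[of 1]
  proof eventually_elim
    case (elim j)
    show ?case
    proof
      fix u :: real assume u: "u \<in> {0..1}"
      have "norm (1 - complex_of_real u) \<le> 1" using u norm_of_real[of "1 - u", where ?'a = complex] by simp
      moreover have "norm (lerch_term 1 (s + 1) (v + of_real u) j)
          \<le> exp (pi * \<bar>Im s\<bar>) * real j powr (- (Re s + 1))"
        using elim u v s by (intro norm_lerch_term_le) auto
      ultimately have "norm (f j u) \<le> 1 * (norm s * (exp (pi * \<bar>Im s\<bar>) * real j powr (- (Re s + 1))))"
        unfolding f_def norm_mult by (intro mult_mono) auto
      then show "norm (f j u) \<le> M j" by (simp add: M_def)
    qed
  qed
  moreover have "summable M"
    unfolding M_def using s by (intro summable_mult) (simp add: summable_real_powr_iff)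
  ultimately have "(\<lambda>j. integral {0..1} (f j)) sums integral {0..1} (\<lambda>u. \<Sum>j. f j u)"
    by (intro integral_sums_M_test contf)
  also have "integral {0..1} (\<lambda>u. \<Sum>j. f j u)
      = integral {0..1} (\<lambda>u. (1 - of_real u) * (s * (\<Sum>j. lerch_term 1 (s + 1) (v + of_real u) j)))"
  proof (rule integral_cong)
    fix u :: real
    have "summable (lerch_term 1 (s + 1) (v + of_real u))"
      using s by (intro summable_norm_cancel[OF summable_norm_lerch_term]) auto
    then show "(\<Sum>j. f j u) = (1 - of_real u) * (s * (\<Sum>j. lerch_term 1 (s + 1) (v + of_real u) j))"
      by (simp add: f_def suminf_mult summable_mult)
  qed
  finally have "(\<lambda>j. (s - 1) * integral {0..1} (f j)) sums
      ((s - 1) * integral {0..1} (\<lambda>u. (1 - of_real u) * (s * (\<Sum>j. lerch_term 1 (s + 1) (v + of_real u) j))))"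
    by (rule sums_mult)
  moreover have "(s - 1) * integral {0..1} (f j)
      = (lerch_term 1 (s - 1) v (Suc j) - lerch_term 1 (s - 1) v j) + (s - 1) * lerch_term 1 s v j" for j
    using integral_powr_remainder[of "of_nat j + v" s] v
    by (simp add: f_def[abs_def] lerch_term_eq algebra_simps)
  moreover have "lerch_term 1 (s - 1) v \<longlonglongrightarrow> 0"
  proof (rule Lim_null_comparison)
    show "\<forall>\<^sub>F j in sequentially. norm (lerch_term 1 (s - 1) v j) \<le> exp (pi * \<bar>Im s\<bar>) * real j powr (- (Re s - 1))"
      using eventually_ge_at_top[of 1]
      by eventually_elim (rule norm_lerch_term_le, use s v in auto)
    have "(\<lambda>j. real j powr (- (Re s - 1))) \<longlonglongrightarrow> 0"
      using s by (intro tendsto_neg_powr filterlim_real_sequentially) auto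
    then show "(\<lambda>j. exp (pi * \<bar>Im s\<bar>) * real j powr (- (Re s - 1))) \<longlonglongrightarrow> 0"
      by (rule tendsto_mult_right_zero)
  qed
  then have "(\<lambda>j. lerch_term 1 (s - 1) v (Suc j) - lerch_term 1 (s - 1) v j) sums (0 - lerch_term 1 (s - 1) v 0)"
    by (rule telescope_sums)
  from sums_add[OF this sums_mult[OF summable_sums[OF summable_norm_cancel[OF summable_norm_lerch_term[OF s, of 1 v]]]]]
  have "(\<lambda>j. (lerch_term 1 (s - 1) v (Suc j) - lerch_term 1 (s - 1) v j) + (s - 1) * lerch_term 1 s v j)
      sums (0 - lerch_term 1 (s - 1) v 0 + (s - 1) * (\<Sum>j. lerch_term 1 s v j))"
    by simp
  ultimately have "0 - lerch_term 1 (s - 1) v 0 + (s - 1) * (\<Sum>j. lerch_term 1 s v j)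
      = (s - 1) * integral {0..1} (\<lambda>u. (1 - of_real u) * (s * (\<Sum>j. lerch_term 1 (s + 1) (v + of_real u) j)))"
    using sums_unique2 by simp
  then show ?thesis by (simp add: lerch_term_eq algebra_simps)
qed

text \<open>
  The function \<open>H\<close> is \<open>(s - 1) \<zeta>(s, v)\<close>, which has no pole. Each application of the recursion gains one
  unit in \<open>Re s\<close>. Joint continuity in \<open>(s, v)\<close> is carried along because the recursion integrates over
  the second argument.
\<close>
lemma hurwitz_half_plane:
  "\<exists>H. continuous_on ({s. Re s > 1 - real m} \<times> {v. Re v > 0}) (\<lambda>(s, v). H s v)
     \<and> (\<forall>v. Re v > 0 \<longrightarrow> (\<lambda>s. H s v) holomorphic_on {s. Re s > 1 - real m})
     \<and> (\<forall>s v. Re s > 1 \<longrightarrow> Re v > 0 \<longrightarrow> H s v = (s - 1) * (\<Sum>j. lerch_term 1 s v j))"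
proof (induction m)
  case 0
  have "continuous_on ({s. Re s > 1} \<times> {v. Re v > 0}) (\<lambda>(s, v). (s - 1) * (\<Sum>j. lerch_term 1 s v j))"
    using continuous_on_hurwitz_series unfolding split_beta by (intro continuous_intros)
  moreover have "(\<lambda>s. (s - 1) * (\<Sum>j. lerch_term 1 s v j)) holomorphic_on {s. Re s > 1}" if "Re v > 0" for v
    using that by (intro holomorphic_intros holomorphic_hurwitz_series)
  ultimately show ?case by (intro exI[of _ "\<lambda>s v. (s - 1) * (\<Sum>j. lerch_term 1 s v j)"]) auto
next
  case (Suc m)
  then obtain H where cont: "continuous_on ({s. Re s > 1 - real m} \<times> {v. Re v > 0}) (\<lambda>(s, v). H s v)"
    and hol: "\<And>v. Re v > 0 \<Longrightarrow> (\<lambda>s. H s v) holomorphic_on {s. Re s > 1 - real m}"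
    and eq: "\<And>s v. Re s > 1 \<Longrightarrow> Re v > 0 \<Longrightarrow> H s v = (s - 1) * (\<Sum>j. lerch_term 1 s v j)"
    by blast
  define P where "P = {s. Re s > 1 - real (Suc m)}"
  define V where "V = {v. Re v > 0}"
  define F where "F p u = (1 - of_real u) * H (fst p + 1) (snd p + of_real u)" for p :: "complex \<times> complex" and u :: real
  define H' where "H' s v = v powr (1 - s) + (s - 1) * integral {0..1} (F (s, v))" for s v
  have "continuous_on ((P \<times> V) \<times> {0..1})
      (\<lambda>q. case (fst (fst q) + 1, snd (fst q) + of_real (snd q)) of (s, v) \<Rightarrow> H s v)"
    by (rule continuous_on_compose2[OF cont]) (auto intro!: continuous_intros simp: P_def V_def)
  then have contF: "continuous_on ((P \<times> V) \<times> {0..1}) (\<lambda>(p, u). F p u)"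
    unfolding F_def split_beta by (intro continuous_intros) simp
  have "continuous_on (P \<times> V) (\<lambda>p. integral {0..1} (F p))"
    using integral_continuous_on_param[of "P \<times> V" 0 1 F] contF by simp
  then have "continuous_on (P \<times> V) (\<lambda>(s, v). H' s v)"
    unfolding H'_def split_beta
    by (intro continuous_intros) (auto simp: V_def complex_eq_iff)
  moreover have "(\<lambda>s. H' s v) holomorphic_on P" if v: "Re v > 0" for v
  proof -
    have "(\<lambda>s. integral {0..1} (F (s, v))) holomorphic_on P"
    proof (rule holomorphic_on_integral_param)
      show "open P" unfolding P_def by (rule open_halfspace_Re_gt)
      have "continuous_on (P \<times> {0..1}) (\<lambda>q. case ((fst q, v), snd q) of (p, u) \<Rightarrow> F p u)"
        by (rule continuous_on_compose2[OF contF]) (use v in \<open>auto intro!: continuous_intros simp: V_def\<close>)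
      then show "continuous_on (P \<times> {0..1}) (\<lambda>(s, u). F (s, v) u)" by (simp add: split_beta)
      show "(\<lambda>s. F (s, v) u) holomorphic_on P" if u: "u \<in> {0..1}" for u
      proof -
        have "(\<lambda>s. H (s + 1) (v + of_real u)) holomorphic_on P"
          by (rule holomorphic_on_compose_gen[OF _ hol, unfolded o_def])
            (use u v in \<open>auto intro!: holomorphic_intros simp: P_def\<close>)
        then show ?thesis unfolding F_def by (auto intro!: holomorphic_intros)
      qed
    qed
    then show ?thesis unfolding H'_def by (intro holomorphic_intros)
  qed
  moreover have "H' s v = (s - 1) * (\<Sum>j. lerch_term 1 s v j)" if s: "Re s > 1" and v: "Re v > 0" for s v
  proof -
    have "integral {0..1} (F (s, v))
        = integral {0..1} (\<lambda>u. (1 - of_real u) * (s * (\<Sum>j. lerch_term 1 (s + 1) (v + of_real u) j)))"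
      by (rule integral_cong) (use s v in \<open>simp add: F_def eq\<close>)
    then show ?thesis unfolding H'_def hurwitz_series_recursion[OF s v] by simp
  qed
  ultimately show ?case unfolding P_def V_def by blast
qed

lemma holomorphic_glue_half_planes:
  assumes "\<And>m::nat. \<exists>f. f holomorphic_on {s. Re s > 1 - real m} \<and> (\<forall>s. Re s > 1 \<longrightarrow> f s = g s)"
  shows "\<exists>f. f holomorphic_on UNIV \<and> (\<forall>s. Re s > 1 \<longrightarrow> f s = g s)"
proof -
  obtain F where hol: "\<And>m::nat. F m holomorphic_on {s. Re s > 1 - real m}"
    and F: "\<And>m s. Re s > 1 \<Longrightarrow> F m s = g s"
    using assms by metis
  have le: "F m s = F n s" if "Re s > 1 - real m" "m \<le> n" for m n s
  proof (rule analytic_continuation_open[of "{s. Re s > 1}" "{s. Re s > 1 - real m}" "F m" "F n"])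
    show "F n holomorphic_on {s. Re s > 1 - real m}"
      using that(2) by (intro holomorphic_on_subset[OF hol[of n]]) auto
    show "{s. Re s > 1} \<noteq> {}" by (auto intro: exI[of _ 2])
  qed (use that hol F in \<open>auto simp: open_halfspace_Re_gt intro!: convex_connected convex_halfspace_Re_gt\<close>)
  \<comment> \<open>Any index would do, as the functions agree wherever two of them are defined.\<close>
  define f where "f s = F (LEAST m. Re s > 1 - real m) s" for s
  have f: "f s = F m s" if "Re s > 1 - real m" for s m
    unfolding f_def using that
    by (intro le LeastI[of "\<lambda>m. Re s > 1 - real m"] Least_le)
  have "f holomorphic_on {s. Re s > 1 - real m}" for m
    by (rule holomorphic_transform[OF hol[of m]]) (simp add: f)
  then have "f holomorphic_on (\<Union>m::nat. {s. Re s > 1 - real m})"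
    by (intro holomorphic_on_UN_open open_halfspace_Re_gt) auto
  then have "f holomorphic_on UNIV" by (simp only: UN_half_planes)
  then show ?thesis using f[of 0] F[of _ 0] by auto
qed

lemma hurwitz_zeta_exists:
  "\<exists>f. f holomorphic_on (- {1}) \<and> (\<forall>s. Re s > 1 \<longrightarrow> lerch_term 1 s v sums f s)"
proof -
  obtain N where N: "Re (v + of_nat N) > 0" using exists_shift by blast
  obtain f where f: "f holomorphic_on UNIV"
    "\<And>s. Re s > 1 \<Longrightarrow> f s = (s - 1) * (\<Sum>j. lerch_term 1 s (v + of_nat N) j)"
    using holomorphic_glue_half_planes[of "\<lambda>s. (s - 1) * (\<Sum>j. lerch_term 1 s (v + of_nat N) j)"]
      hurwitz_half_plane N by meson
  have "(\<lambda>s. (\<Sum>j<N. lerch_term 1 s v j) + 1 ^ N * (f s / (s - 1))) holomorphic_on - {1}"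
    unfolding lerch_term_eq using f(1)
    by (intro holomorphic_intros) (auto intro: holomorphic_on_subset)
  moreover have "lerch_term 1 s v sums ((\<Sum>j<N. lerch_term 1 s v j) + 1 ^ N * (f s / (s - 1)))" if s: "Re s > 1" for s
  proof (rule lerch_term_sums_shift)
    have "s \<noteq> 1" using s by auto
    then show "lerch_term 1 s (v + of_nat N) sums (f s / (s - 1))"
      using f(2)[OF s] summable_sums[OF summable_norm_cancel[OF summable_norm_lerch_term[OF s]]] by simp
  qed
  ultimately show ?thesis by blast
qed

lemma lerch_phi_1: "lerch_phi 1 s v = hurwitz_zeta s v"
  and holomorphic_hurwitz_zeta: "(\<lambda>s. hurwitz_zeta s v) holomorphic_on - {1}"
proof -
  define f where "f = (SOME f. f holomorphic_on (- {1}) \<and> (\<forall>s. Re s > 1 \<longrightarrow> lerch_term 1 s v sums f s))"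
  have f: "hurwitz_zeta s v = f s" for s by (simp add: hurwitz_zeta_def f_def)
  have *: "f holomorphic_on (- {1}) \<and> (\<forall>s. Re s > 1 \<longrightarrow> lerch_term 1 s v sums f s)"
    unfolding f_def by (rule someI_ex[OF hurwitz_zeta_exists])
  then show "(\<lambda>s. hurwitz_zeta s v) holomorphic_on - {1}" by (simp add: f)
  show "lerch_phi 1 s v = hurwitz_zeta s v"
    using * by (auto simp: lerch_phi_def f sums_iff)
qed

section \<open>Trisection of the Lerch function\<close>

lemma cube_root_sum:
  fixes q :: complex
  assumes "q ^ 3 = 1" "q \<noteq> 1"
  shows "1 + q + q ^ 2 = 0"
proof -
  have "(q - 1) * (1 + q + q ^ 2) = 0" using assms(1) by (simp add: algebra_simps power2_eq_square power3_eq_cube)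
  then show ?thesis using assms(2) by simp
qed

text \<open>
  Combined, the three series on the left have the terms
  \<open>w^(j+1) (j+v)^(-s) (1 + q^(j+1) + q^(2(j+1)))\<close>, which vanish unless \<open>j = 3 l + 2\<close>; then
  \<open>j + v = 3 (l + v')\<close>, and the real factor 3 can be taken out of the power.
\<close>
lemma lerch_trisection_series:
  fixes w q s v v' :: complex
  assumes q: "q ^ 3 = 1" "q \<noteq> 1" and v: "3 * v' = v + 2"
    and sums: "lerch_term w s v sums a0" "lerch_term (q * w) s v sums a1"
      "lerch_term (q ^ 2 * w) s v sums a2" "lerch_term (w ^ 3) s v' sums b"
  shows "w * a0 + q * w * a1 + q ^ 2 * w * a2 = 3 powr (1 - s) * w ^ 3 * b"
proof -
  \<comment> \<open>The blocks of three consecutive terms are the terms of the series on the right.\<close>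
  define g where "g j = w * lerch_term w s v j + q * w * lerch_term (q * w) s v j
      + q ^ 2 * w * lerch_term (q ^ 2 * w) s v j" for j
  have g: "g j = w ^ Suc j * (of_nat j + v) powr (-s) * (1 + q ^ Suc j + (q ^ Suc j) ^ 2)" for j
    by (simp add: g_def lerch_term_eq power_mult_distrib power2_eq_square algebra_simps)
  have q3: "q ^ (3 * l) = 1" for l by (simp add: power_mult q(1))
  have zero: "1 + q + q * q = 0" using cube_root_sum[OF q] by (simp add: power2_eq_square)
  have q4: "(q * q)\<^sup>2 = q"
  proof -
    have "(q * q)\<^sup>2 = q ^ 3 * q" by (simp add: power2_eq_square power3_eq_cube)
    then show ?thesis using q(1) by simp
  qed
  have block: "sum g {l * 3..<l * 3 + 3} = 3 powr (1 - s) * w ^ 3 * lerch_term (w ^ 3) s v' l" for l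
  proof -
    have p1: "q ^ Suc (3 * l) = q" "q ^ Suc (3 * l + 1) = q * q" "q ^ Suc (3 * l + 2) = 1"
      using q(1) by (simp_all add: q3 power_add power3_eq_cube power2_eq_square mult.assoc)
    have "g (3 * l) = 0" unfolding g p1 using zero by (simp add: power2_eq_square)
    moreover have "g (3 * l + 1) = 0" unfolding g p1 q4 using zero by (simp add: add_ac)
    moreover have "g (3 * l + 2) = 3 powr (1 - s) * w ^ 3 * lerch_term (w ^ 3) s v' l"
    proof -
      have "of_nat (3 * l + 2) + v = 3 * (of_nat l + v')" using v by (simp add: algebra_simps)
      then have "(of_nat (3 * l + 2) + v) powr (-s) = 3 powr (-s) * (of_nat l + v') powr (-s)"
        by (simp only:, subst powr_times_real_left) auto
      moreover have "(3 :: complex) powr (1 - s) = 3 * 3 powr (-s)"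
        using powr_add[of "3 :: complex" 1 "-s"] by simp
      ultimately show ?thesis
        unfolding g p1 lerch_term_eq by (simp add: power_add power_mult power3_eq_cube power2_eq_square)
    qed
    moreover have "{l * 3..<l * 3 + 3} = {3 * l, 3 * l + 1, 3 * l + 2}" by auto
    ultimately show ?thesis by simp
  qed
  have "g sums (w * a0 + q * w * a1 + q ^ 2 * w * a2)"
    unfolding g_def by (intro sums_add sums_mult sums)
  from sums_group[OF this, of 3]
  have "(\<lambda>l. 3 powr (1 - s) * w ^ 3 * lerch_term (w ^ 3) s v' l) sums (w * a0 + q * w * a1 + q ^ 2 * w * a2)"
    by (simp add: block)
  moreover have "(\<lambda>l. 3 powr (1 - s) * w ^ 3 * lerch_term (w ^ 3) s v' l) sums (3 powr (1 - s) * w ^ 3 * b)"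
    by (intro sums_mult sums)
  ultimately show ?thesis by (rule sums_unique2)
qed

lemma cube_in_lerch_cut: "x \<in> lerch_cut \<Longrightarrow> x ^ 3 \<in> lerch_cut"
  unfolding lerch_cut_def by (auto simp flip: of_real_power intro!: imageI one_le_power)

lemma cube_eq_1_in_lerch_cut: "x \<in> lerch_cut \<Longrightarrow> x ^ 3 = 1 \<Longrightarrow> x = 1"
proof -
  assume x: "x \<in> lerch_cut" "x ^ 3 = 1"
  then obtain t :: real where t: "x = of_real t" "t \<ge> 1" by (auto simp: lerch_cut_def)
  have "complex_of_real (t ^ 3) = of_real 1" using x(2) t(1) by simp
  then have "t ^ 3 = 1" by (simp only: of_real_eq_iff)
  then have "t = 1" using power_eq_1_iff[of t 3] t(2) by auto
  then show "x = 1" using t by simp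
qed

text \<open>
  The argument is either 1, where the value is a Hurwitz zeta value, or off the cut, where the function
  is even entire.
\<close>
lemma holomorphic_lerch_phi_cube_root:
  assumes "x ^ 3 = 1"
  shows "(\<lambda>s. lerch_phi x s v) holomorphic_on - {1}"
proof (cases "x \<in> lerch_cut")
  case True
  then have "x = 1" using cube_eq_1_in_lerch_cut assms by blast
  then show ?thesis by (simp add: lerch_phi_1 holomorphic_hurwitz_zeta)
next
  case False
  then show ?thesis
    using holomorphic_on_subset[OF holomorphic_lerch_phi_continuation_exponent[OF False]]
    by (simp add: lerch_phi_eq_continuation)
qed

lemma holomorphic_lerch_phi: "(\<lambda>z. lerch_phi z s v) holomorphic_on - lerch_cut"
  by (rule holomorphic_transform[OF holomorphic_lerch_phi_continuation[of s v]])
    (simp add: lerch_phi_eq_continuation)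

lemma lerch_term_sums_lerch_phi_disc: "norm z < 1 \<Longrightarrow> lerch_term z s v sums lerch_phi z s v"
  using ball_subset_Compl_lerch_cut lerch_term_sums_lerch_phi_continuation[of z s v]
  by (subst lerch_phi_eq_continuation) auto

text \<open>
  Off the cut the identity is continued in \<open>w\<close>, at the cube roots of unity it is continued in \<open>s\<close>. A
  condition on \<open>w\<^sup>3\<close> suffices because the cut is closed under cubing and contains only one cube root
  of 1.
\<close>
lemma lerch_trisection:
  fixes w q s v v' :: complex
  assumes q: "q ^ 3 = 1" "q \<noteq> 1" and v: "3 * v' = v + 2"
    and w: "w ^ 3 \<notin> lerch_cut \<or> w ^ 3 = 1 \<and> s \<noteq> 1"
  shows "w * lerch_phi w s v + q * w * lerch_phi (q * w) s v + q ^ 2 * w * lerch_phi (q ^ 2 * w) s v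
       = 3 powr (1 - s) * w ^ 3 * lerch_phi (w ^ 3) s v'"
proof -
  have qc: "(q * z) ^ 3 = z ^ 3" "(q ^ 2 * z) ^ 3 = z ^ 3" for z
    using q(1) power_mult[of q 3 2] by (simp_all add: power_mult_distrib flip: power_mult)
  have nq: "norm q = 1" using q(1) norm_power[of q 3] power_eq_1_iff[of "norm q" 3] by simp
  show ?thesis
  proof (cases "w ^ 3 \<in> lerch_cut")
    case False
    define D where "D = {z. z ^ 3 \<notin> lerch_cut}"
    have "open ((\<lambda>z. z ^ 3) -` (- lerch_cut))"
      by (intro open_vimage open_Compl_lerch_cut continuous_intros)
    then have D: "open D" by (simp add: D_def vimage_def)
    have mem: "z \<in> - lerch_cut" "q * z \<in> - lerch_cut" "q ^ 2 * z \<in> - lerch_cut" "z ^ 3 \<in> - lerch_cut"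
      if "z \<in> D" for z
      using that cube_in_lerch_cut[of z] cube_in_lerch_cut[of "q * z"] cube_in_lerch_cut[of "q ^ 2 * z"]
      by (auto simp: D_def qc)
    have "starlike D"
      unfolding starlike_def
    proof (intro bexI ballI subsetI)
      fix z u assume z: "z \<in> D" and u: "u \<in> closed_segment 0 z"
      then obtain x where x: "x \<in> {0..1}" "u = z * of_real x"
        by (auto simp: closed_segment_def scaleR_conv_of_real mult.commute)
      have "z ^ 3 * of_real (x ^ 3) \<notin> lerch_cut"
        using z x(1) by (intro scale_notin_lerch_cut) (auto simp: D_def power_le_one)
      then show "u \<in> D" by (simp add: D_def x power_mult_distrib)
    qed (auto simp: D_def lerch_cut_eq)
    then have conn: "connected D" by (rule starlike_imp_connected)
    have small: "z \<in> D" if "norm z < 1" for z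
    proof -
      have "norm (z ^ 3) < 1" using that by (simp add: norm_power power_less_one_iff)
      then show ?thesis using ball_subset_Compl_lerch_cut by (auto simp: D_def)
    qed
    show ?thesis
    proof (rule analytic_continuation_open[of "ball 0 1" D
          "\<lambda>w. w * lerch_phi w s v + q * w * lerch_phi (q * w) s v + q ^ 2 * w * lerch_phi (q ^ 2 * w) s v"
          "\<lambda>w. 3 powr (1 - s) * w ^ 3 * lerch_phi (w ^ 3) s v'"])
      show "(\<lambda>w. w * lerch_phi w s v + q * w * lerch_phi (q * w) s v + q ^ 2 * w * lerch_phi (q ^ 2 * w) s v)
          holomorphic_on D"
        by (intro holomorphic_intros
            holomorphic_on_compose_gen[OF _ holomorphic_lerch_phi, unfolded o_def]) (use mem in auto)
      show "(\<lambda>w. 3 powr (1 - s) * w ^ 3 * lerch_phi (w ^ 3) s v') holomorphic_on D"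
        by (intro holomorphic_intros
            holomorphic_on_compose_gen[OF _ holomorphic_lerch_phi, unfolded o_def]) (use mem in auto)
      show "z * lerch_phi z s v + q * z * lerch_phi (q * z) s v + q ^ 2 * z * lerch_phi (q ^ 2 * z) s v
          = 3 powr (1 - s) * z ^ 3 * lerch_phi (z ^ 3) s v'" if "z \<in> ball 0 1" for z
        using that
        by (intro lerch_trisection_series[OF q v] lerch_term_sums_lerch_phi_disc)
          (auto simp: norm_mult norm_power nq power_less_one_iff)
    qed (use D conn small False in \<open>auto simp: D_def\<close>)
  next
    case True
    with w have w3: "w ^ 3 = 1" and s: "s \<noteq> 1" by auto
    have nw: "norm w = 1" using w3 norm_power[of w 3] power_eq_1_iff[of "norm w" 3] by simp
    show ?thesis
    proof (rule analytic_continuation_open[of "{s. Re s > 1}" "- {1}"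
          "\<lambda>s. w * lerch_phi w s v + q * w * lerch_phi (q * w) s v + q ^ 2 * w * lerch_phi (q ^ 2 * w) s v"
          "\<lambda>s. 3 powr (1 - s) * w ^ 3 * lerch_phi (w ^ 3) s v'"])
      show "{s. 1 < Re s} \<noteq> {}" by (auto intro: exI[of _ 2])
      show "connected (- {1 :: complex})" by (intro connected_punctured_universe) simp
      show "(\<lambda>s. w * lerch_phi w s v + q * w * lerch_phi (q * w) s v + q ^ 2 * w * lerch_phi (q ^ 2 * w) s v)
          holomorphic_on - {1}"
        by (intro holomorphic_intros holomorphic_lerch_phi_cube_root) (simp_all add: qc w3)
      show "(\<lambda>s. 3 powr (1 - s) * w ^ 3 * lerch_phi (w ^ 3) s v') holomorphic_on - {1}"
        by (intro holomorphic_intros holomorphic_lerch_phi_cube_root) (simp_all add: w3)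
      show "w * lerch_phi w s v + q * w * lerch_phi (q * w) s v + q ^ 2 * w * lerch_phi (q ^ 2 * w) s v
          = 3 powr (1 - s) * w ^ 3 * lerch_phi (w ^ 3) s v'" if "s \<in> {s. Re s > 1}" for s
        using that
        by (intro lerch_trisection_series[OF q v] lerch_term_sums_lerch_phi)
          (auto simp: norm_mult norm_power nq nw)
    qed (use s in \<open>auto simp: open_halfspace_Re_gt\<close>)
  qed
qed

section \<open>The telescoping sum\<close>

theorem theorem4p144:
  fixes n :: nat and k r a :: complex
  assumes "n \<ge> 1"
    and "\<And>p. p \<in> {1..n} \<Longrightarrow>
           lerch_phi_defined (- ((-1) powr (1/3)) * exp (\<i> * (1 / 3^p) * pi * r)) (-k) (1 + 3^p * a)"
    and "\<And>p. p \<in> {1..n} \<Longrightarrow>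
           lerch_phi_defined ((-1) powr (2/3) * exp (\<i> * (1 / 3^p) * pi * r)) (-k) (1 + 3^p * a)"
    and "lerch_phi_defined (exp (\<i> * pi * r)) (-k) (1 + a)"
    and "lerch_phi_defined (exp (\<i> * (1 / 3^n) * pi * r)) (-k) (1 + 3^n * a)"
  shows "(\<Sum>p=1..n. (\<i> * (1 / 3^p)) powr (1 + k) *
            ((-1) powr (1/3) * exp (\<i> * (1 / 3^p) * pi * r) *
               lerch_phi (- ((-1) powr (1/3)) * exp (\<i> * (1 / 3^p) * pi * r)) (-k) (1 + 3^p * a)
             + exp (pi * (- (\<i> / 3) + \<i> * (1 / 3^p) * r)) *
               lerch_phi ((-1) powr (2/3) * exp (\<i> * (1 / 3^p) * pi * r)) (-k) (1 + 3^p * a)))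
         = - \<i> * exp (1/2 * \<i> * pi * (k + 2 * r)) * lerch_phi (exp (\<i> * pi * r)) (-k) (1 + a)
           + (\<i> * (1 / 3^n)) powr (1 + k) * exp (\<i> * (1 / 3^n) * pi * r) *
               lerch_phi (exp (\<i> * (1 / 3^n) * pi * r)) (-k) (1 + 3^n * a)"
proof -
  define w where "w p = exp (\<i> * (1 / 3^p) * pi * r)" for p :: nat
  \<comment> \<open>The quantity whose differences are the summands.\<close>
  define X where "X p = (\<i> * (1 / 3^p)) powr (1 + k) * w p * lerch_phi (w p) (-k) (1 + 3^p * a)" for p :: nat
  define q :: complex where "q = (-1) powr (2/3)"
  have q_exp: "q = exp (2 * pi * \<i> / 3)"
    by (simp add: q_def powr_def field_simps)
  have q_cis: "q = cis (2 * pi / 3)"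
    by (simp add: q_exp cis_conv_exp mult_ac)
  have q3: "q ^ 3 = 1"
    by (simp add: q_cis Complex.DeMoivre)
  have q1: "q \<noteq> 1"
    by (simp add: q_cis complex_eq_iff cos_120)
  have exp_q: "exp (- (\<i> * pi / 3)) = - q"
  proof -
    have "exp (- (\<i> * pi / 3)) * exp (\<i> * pi) = exp (2 * pi * \<i> / 3)"
      unfolding exp_add[symmetric] by (rule arg_cong[of _ _ exp]) (simp add: field_simps)
    then have "- exp (- (\<i> * pi / 3)) = q" by (simp add: q_exp)
    then show ?thesis by (metis minus_minus)
  qed
  have root: "(-1) powr (1/3) = - (q ^ 2)"
  proof -
    have "(-1 :: complex) powr (1/3) = exp (\<i> * pi / 3)" by (simp add: powr_def)
    moreover have "exp (\<i> * pi / 3) * exp (\<i> * pi) = q ^ 2"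
      unfolding q_exp exp_add[symmetric] exp_of_nat_mult[symmetric]
      by (rule arg_cong[of _ _ exp]) (simp add: field_simps)
    ultimately have "- ((-1) powr (1/3)) = q ^ 2" by simp
    then show ?thesis by (metis minus_minus)
  qed
  have w_cube: "w (Suc p) ^ 3 = w p" for p
    by (simp add: w_def flip: exp_of_nat_mult)
  \<comment> \<open>Regularity at the argument \<open>exp (i \<pi> r)\<close> is inherited by all iterated cube roots.\<close>
  have regular: "w p \<notin> lerch_cut \<or> w p = 1 \<and> - k \<noteq> 1" for p
  proof (induction p)
    case 0
    then show ?case using assms(4) by (simp add: w_def lerch_phi_defined_def)
  next
    case (Suc p)
    then show ?case
      using cube_in_lerch_cut[of "w (Suc p)"] cube_eq_1_in_lerch_cut[of "w (Suc p)"] by (auto simp: w_cube)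
  qed
  have step: "(\<i> * (1 / 3^p)) powr (1 + k) *
            ((-1) powr (1/3) * exp (\<i> * (1 / 3^p) * pi * r) *
               lerch_phi (- ((-1) powr (1/3)) * exp (\<i> * (1 / 3^p) * pi * r)) (-k) (1 + 3^p * a)
             + exp (pi * (- (\<i> / 3) + \<i> * (1 / 3^p) * r)) *
               lerch_phi ((-1) powr (2/3) * exp (\<i> * (1 / 3^p) * pi * r)) (-k) (1 + 3^p * a))
      = X p - X (p - 1)" if p: "p \<ge> 1" for p
  proof -
    obtain m where m: "p = Suc m" using p by (cases p) auto
    define c where "c p = (\<i> * (1 / 3^p)) powr (1 + k)" for p :: nat
    define L where "L z = lerch_phi z (-k) (1 + 3^p * a)" for z
    have e: "exp (pi * (- (\<i> / 3) + \<i> * (1 / 3^p) * r)) = - q * w p"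
      unfolding w_def exp_q[symmetric] exp_add[symmetric]
      by (rule arg_cong[of _ _ exp]) (simp add: field_simps)
    have tri: "w p * L (w p) + q * w p * L (q * w p) + q ^ 2 * w p * L (q ^ 2 * w p)
        = 3 powr (1 + k) * w m * lerch_phi (w m) (-k) (1 + 3^m * a)"
      using lerch_trisection[OF q3 q1, of "1 + 3^m * a" "1 + 3^p * a" "w p" "-k"] regular[of m]
      by (simp add: m w_cube L_def)
    have "c m = (3 * (\<i> * (1 / 3^p))) powr (1 + k)" by (simp add: c_def m)
    also have "\<dots> = 3 powr (1 + k) * c p" unfolding c_def by (rule powr_times_real_left) auto
    finally have cm: "c m = 3 powr (1 + k) * c p" .
    have "c p * (- (q ^ 2) * w p * L (q ^ 2 * w p) + - q * w p * L (q * w p))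
        = c p * (w p * L (w p) - (w p * L (w p) + q * w p * L (q * w p) + q ^ 2 * w p * L (q ^ 2 * w p)))"
      by (simp add: algebra_simps)
    also have "\<dots> = c p * (w p * L (w p) - 3 powr (1 + k) * w m * lerch_phi (w m) (-k) (1 + 3^m * a))"
      by (simp only: tri)
    also have "\<dots> = X p - X m"
      unfolding X_def c_def[symmetric] cm L_def by (simp add: algebra_simps)
    finally show ?thesis
      unfolding e root using m by (simp add: c_def L_def w_def q_def)
  qed
  have "(\<Sum>p=1..n. X p - X (p - 1)) = X n - X 0"
    by (induction n) simp_all
  moreover have "X 0 = \<i> * exp (1/2 * \<i> * pi * (k + 2 * r)) * lerch_phi (exp (\<i> * pi * r)) (-k) (1 + a)"
  proof -
    have "\<i> powr (1 + k) * exp (\<i> * pi * r) = exp (\<i> * pi / 2) * exp (1/2 * \<i> * pi * (k + 2 * r))"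
      unfolding powr_def exp_add[symmetric]
      by (simp flip: exp_add) (simp add: field_simps)
    moreover have "exp (\<i> * pi / 2) = \<i>"
      using cis_pi_half by (simp add: cis_conv_exp)
    ultimately show ?thesis by (simp add: X_def w_def)
  qed
  ultimately show ?thesis
    using step by (simp add: X_def w_def)
qed

end
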